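(* Consider the weighted potential stochastic Nash game and the asynchronous inexact proximal best-response scheme described in the context, and suppose that the assumptions (A1), (A2), (A3) listed there hold, with weights $w_1,\dots,w_N>0$. Let the proximal parameter $\mu_i$ satisfy, for every $i\in\mathcal N$, $$\mu_i>\frac{L_i}{2}+\frac{\sqrt2\,\tau L_i}{2}\left(\frac{L_{\rm ave}}{L_i}\frac{w_{\rm ave}}{w_i}+\frac{L_i}{L_{\rm ave}}\frac{w_i}{w_{\rm ave}}\right),\qquad L_{\rm ave}=\frac1N\sum_{i\in\mathcal N}L_i,\quad w_{\rm ave}=\frac1N\sum_{i\in\mathcal N}w_i .$$ Let $\{x(k)\}$ be the sequence generated by the scheme. Then: (a) For any $i\in\mathcal N$, $\sum_{k=0}^\infty\|T_i(y^i(k))-x_i(k)\|^2<\infty$ a.s. (b) For almost all $\omega$, every limit point of $\{x(k,\omega)\}$ is a Nash equilibrium. (c) There exists a connected subset $X_c^*\subset X^*$ of the set $X^*$ of Nash equilibria such that $d(x(k),X_c^* )\to0$ as $k\to\infty$ a.s., where $d(x,A)=\inf_{a\in A}\|x-a\|$. (d) $\lim_{k\to\infty}\mathbb E[G(x(k))]=0$, where $G(x)=\sup_{y\in X}\nabla_xP(x)^T(x-y)$ for $x\in X$.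
   Context: **Game.** Players $\mathcal N=\{1,\dots,N\}$; player $i$ has strategy $x_i\in X_i\subset\mathbb R^{n_i}$; $X=\prod_{i=1}^N X_i$, $X_{-i}=\prod_{j\ne i}X_j$, $x_{-i}=(x_j)_{j\neq i}$. Given $x_{-i}$, player $i$ solves $\min_{x_i\in X_i} f_i(x_i,x_{-i})$ with $f_i(x_i,x_{-i})=\mathbb E_\xi[\psi_i(x_i,x_{-i};\xi)]$, where $\xi$ is an $\mathbb R^d$-valued random vector and $\psi_i$ is scalar-valued. A Nash equilibrium is $x^*\in X$ with $f_i(x_i^*,x_{-i}^* )\le f_i(x_i,x_{-i}^* )$ for all $x_i\in X_i$ and all $i\in\mathcal N$; $X^*$ is the set of Nash equilibria. $\|\cdot\|$ is the Euclidean norm. **(A1)** (a) For every $i$, $X_i$ is closed, compact and convex. (b) For every $i$, $f_i(x_i,x_{-i})$ is convex and continuously differentiable in $x_i\in X_i$ for every $x_{-i}\in X_{-i}$, and there is $L_i>0$ with $\|\nabla_{x_i}f_i(x)-\nabla_{x_i}f_i(x')\|\le L_i\|x-x'\|$ for all $x,x'\in X$. (c) For every $i$, all $x_{-i}\in X_{-i}$ and every realization of $\xi$, $\psi_i(x_i,x_{-i};\xi)$ is differentiable in $x_i$ over an open set containing $X_i$, with $\nabla_{x_i}f_i(x_i,x_{-i})=\mathbb E_\xi[\nabla_{x_i}\psi_i(x_i,x_{-i};\xi)]$. (d) For every $i$ and any $x\in X$, there exists a constant $M>0$ such that $\mathbb E_\xi[\|\nabla_{x_i}\psi_i(x_i,x_{-i};\xi)\|^2]\le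 M^2$. **(A2) (weighted potential)** There are positive numbers $w_1,\dots,w_N$ and a function $P:X\to\mathbb R$, continuously differentiable over an open set containing $X$, such that for any $i$ and any $x_{-i}\in X_{-i}$, $P(x_i,x_{-i})-P(x_i',x_{-i})=w_i\big(f_i(x_i,x_{-i})-f_i(x_i',x_{-i})\big)$ for all $x_i,x_i'\in X_i$. **Proximal best response.** For $\mu_i>0$ and $x\in X$, $T_i(x)=\arg\min_{y_i\in X_i}\big[f_i(y_i,x_{-i})+\frac{\mu_i}{2}\|y_i-x_i\|^2\big]$. **Scheme.** Start with $x_i(0)\in X_i$ for $i\in\mathcal N$; fix $0<p_i<1$ with $\sum_i p_i=1$. At iteration $k\ge0$, a player $i_k$ is picked randomly, with $\mathbb P(i_k=i)=p_i$. Player $i$ has access to the delayed vector $y^i(k)=(x_1(k-d_{i1}(k)),\dots,x_N(k-d_{iN}(k)))$, where $d_{ij}(k)$ are (random) delays with $d_{ii}(k)=0$. If $i_k=i$, then $x_i(k+1)=T_i(y^i(k))+\varepsilon_i(k+1)\in X_i$, and $x_j(k+1)=x_j(k)$ for $j\ne i_k$. Here $\varepsilon_i(k+1)$ denotes the inexactness with which player $i$ computes $T_i(y^i(k))$ (by a stochastic approximation scheme using a vector $\xi_i(k)$ of finitely many samples of $\xi$). Write $x(k)=(x_1(k),\dots,x_N(k))$. **$\sigma$-fields.** $\mathcal F_k'$ is the $\sigma$-field of the entire information used by the scheme up to and including the update of $x(k)$, namely $\mathcal F_k'=\sigma\{x(0),i_l,\xi_{i_l}(l),d_{i_l,j}(l):0\le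 l\le k-1,\ j\in\mathcal N\}$; and $\mathcal F_k=\sigma\{\mathcal F_k',d_{ij}(k),\ i,j\in\mathcal N\}$. **(A3)** (a) $i_k$ is independent of $\mathcal F_k$ for all $k\ge1$. (b) For any $i$, $\sum_{k=1}^\infty\mathbb E[\|\varepsilon_i(k+1)\|^2\mid\mathcal F_k]<\infty$ a.s. and $\sum_{k=1}^\infty\mathbb E[\|\varepsilon_i(k+1)\|\mid\mathcal F_k]<\infty$ a.s. (c) There is a positive integer $\tau$ such that $d_{ij}(k)\in\{0,\dots,\tau\}$ for any $i,j\in\mathcal N$ and any $k\ge0$.
   Formalization: In (c) the connected set X_c^* of Nash equilibria may depend on the outcome ω (with one fixed set the claim fails, e.g. for f_1=f_2=-x_1x_2 on [-1,1]^2); the samples of ξ are read as fresh i.i.d. draws, independent of F_k. *)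

theory Defs
  imports "HOL-Probability.Probability"
begin

text \<open>
  The strategy spaces \<open>R^{n_i}\<close> may have different dimensions. A strategy profile
  \<open>x = (x_1, \<dots>, x_N)\<close> is the concatenated vector \<open>x :: real ^ 'c\<close>, where a map
  \<open>own :: 'c \<Rightarrow> 'i\<close> assigns each coordinate to the player who controls it, so that
  \<open>n_i = card {c. own c = i}\<close>. The space \<open>R^{n_i}\<close> is the subspace \<open>block own i\<close> of vectors that
  vanish outside the coordinates of player \<open>i\<close>; norms and inner products agree with those
  of \<open>R^{n_i}\<close>.
\<close>

definition block :: "('c::finite \<Rightarrow> 'i) \<Rightarrow> 'i \<Rightarrow> (real ^ 'c) set" where
  "block own i = {v. \<forall>c. own c \<noteq> i \<longrightarrow> v $ c = 0}"

definition proj :: "('c::finite \<Rightarrow> 'i) \<Rightarrow> 'i \<Rightarrow> real ^ 'c \<Rightarrow> real ^ 'c" where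
  "proj own i x = (\<chi> c. if own c = i then x $ c else 0)"

text \<open>\<open>upd own i y x\<close> is the profile \<open>(y_i, x_{-i})\<close>.\<close>

definition upd :: "('c::finite \<Rightarrow> 'i) \<Rightarrow> 'i \<Rightarrow> real ^ 'c \<Rightarrow> real ^ 'c \<Rightarrow> real ^ 'c" where
  "upd own i y x = (\<chi> c. if own c = i then y $ c else x $ c)"

definition profiles :: "('c::finite \<Rightarrow> 'i) \<Rightarrow> ('i \<Rightarrow> (real ^ 'c) set) \<Rightarrow> (real ^ 'c) set" where
  "profiles own X = {x. \<forall>i. proj own i x \<in> X i}"

definition gradient :: "('a::real_inner \<Rightarrow> real) \<Rightarrow> 'a \<Rightarrow> 'a" where
  "gradient F x = (THE D. GDERIV F x :> D)"

text \<open>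
  Partial gradient with respect to \<open>x_i\<close>. The function \<open>\<lambda>z. F (upd own i z x)\<close> ignores the
  coordinates outside block \<open>i\<close>, so its derivative on \<open>real ^ 'c\<close> exists iff the one on
  \<open>R^{n_i}\<close> does, and its gradient lies in \<open>block own i\<close>.
\<close>

definition pgrad ::
  "('c::finite \<Rightarrow> 'i) \<Rightarrow> 'i \<Rightarrow> (real ^ 'c \<Rightarrow> real) \<Rightarrow> real ^ 'c \<Rightarrow> real ^ 'c" where
  "pgrad own i F x = gradient (\<lambda>z. F (upd own i z x)) x"

definition nash ::
  "('c::finite \<Rightarrow> 'i) \<Rightarrow> ('i \<Rightarrow> (real ^ 'c) set) \<Rightarrow> ('i \<Rightarrow> real ^ 'c \<Rightarrow> real) \<Rightarrow> (real ^ 'c) set" where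
  "nash own X f =
     {x \<in> profiles own X. \<forall>i. \<forall>y\<in>X i. f i x \<le> f i (upd own i y x)}"

definition prox ::
  "('c::finite \<Rightarrow> 'i) \<Rightarrow> ('i \<Rightarrow> (real ^ 'c) set) \<Rightarrow> ('i \<Rightarrow> real ^ 'c \<Rightarrow> real) \<Rightarrow> ('i \<Rightarrow> real)
     \<Rightarrow> 'i \<Rightarrow> real ^ 'c \<Rightarrow> real ^ 'c" where
  "prox own X f \<mu> i x =
     arg_min_on (\<lambda>y. f i (upd own i y x) + \<mu> i / 2 * (norm (y - proj own i x))\<^sup>2) (X i)"

definition gap ::
  "('c::finite \<Rightarrow> 'i) \<Rightarrow> ('i \<Rightarrow> (real ^ 'c) set) \<Rightarrow> (real ^ 'c \<Rightarrow> real) \<Rightarrow> real ^ 'c \<Rightarrow> real" where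
  "gap own X P x = (SUP y\<in>profiles own X. gradient P x \<bullet> (x - y))"

definition avg :: "('i::finite \<Rightarrow> real) \<Rightarrow> real" where
  "avg v = (\<Sum>i\<in>UNIV. v i) / real CARD('i)"


text \<open>
  The random vector \<open>\<xi>\<close> in \<open>f_i(x) = E[\<psi>_i(x; \<xi>)]\<close> lives on a probability space \<open>Q\<close> of its own.
  The costs \<open>f\<close> and \<open>\<psi>\<close> are total functions; their values outside the feasible set matter only
  for the existence of gradients at boundary points. Quantifying over \<open>x \<in> profiles own X\<close> and
  using only \<open>upd own i y x\<close> amounts to quantifying over \<open>x_{-i} \<in> X_{-i}\<close>.
\<close>

definition stochastic_game ::
  "('c::finite \<Rightarrow> 'i::finite) \<Rightarrow> ('i \<Rightarrow> (real ^ 'c) set) \<Rightarrow> ('i \<Rightarrow> real ^ 'c \<Rightarrow> real)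
     \<Rightarrow> ('i \<Rightarrow> real ^ 'c \<Rightarrow> real ^ 'd::finite \<Rightarrow> real) \<Rightarrow> 'q measure \<Rightarrow> ('q \<Rightarrow> real ^ 'd) \<Rightarrow> bool" where
  "stochastic_game own X f \<psi> Q \<xi> \<longleftrightarrow>
     surj own \<and> (\<forall>i. X i \<subseteq> block own i) \<and>
     prob_space Q \<and> \<xi> \<in> borel_measurable Q \<and>
     (\<forall>i. \<forall>x\<in>profiles own X. has_bochner_integral Q (\<lambda>q. \<psi> i x (\<xi> q)) (f i x))"

definition assumption_A1 ::
  "('c::finite \<Rightarrow> 'i::finite) \<Rightarrow> ('i \<Rightarrow> (real ^ 'c) set) \<Rightarrow> ('i \<Rightarrow> real ^ 'c \<Rightarrow> real)
     \<Rightarrow> ('i \<Rightarrow> real ^ 'c \<Rightarrow> real ^ 'd::finite \<Rightarrow> real) \<Rightarrow> 'q measure \<Rightarrow> ('q \<Rightarrow> real ^ 'd)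
     \<Rightarrow> ('i \<Rightarrow> real) \<Rightarrow> bool" where
  "assumption_A1 own X f \<psi> Q \<xi> L \<longleftrightarrow>
     (\<forall>i. closed (X i) \<and> compact (X i) \<and> convex (X i)) \<and>
     (\<forall>i. \<forall>x\<in>profiles own X.
        convex_on (X i) (\<lambda>y. f i (upd own i y x)) \<and>
        (\<forall>y\<in>X i. (\<lambda>z. f i (upd own i z x)) differentiable (at y)) \<and>
        continuous_on (X i) (\<lambda>y. pgrad own i (f i) (upd own i y x))) \<and>
     (\<forall>i. L i > 0 \<and>
        (\<forall>x\<in>profiles own X. \<forall>x'\<in>profiles own X.
           norm (pgrad own i (f i) x - pgrad own i (f i) x') \<le> L i * norm (x - x'))) \<and>
     (\<forall>i. \<forall>x\<in>profiles own X. \<forall>q\<in>space Q.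
        \<exists>U. openin (top_of_set (block own i)) U \<and> X i \<subseteq> U \<and>
            (\<forall>y\<in>U. (\<lambda>z. \<psi> i (upd own i z x) (\<xi> q)) differentiable (at y))) \<and>
     (\<forall>i. \<forall>x\<in>profiles own X.
        has_bochner_integral Q (\<lambda>q. pgrad own i (\<lambda>z. \<psi> i z (\<xi> q)) x) (pgrad own i (f i) x)) \<and>
     (\<forall>i. \<forall>x\<in>profiles own X. \<exists>m>0.
        (\<integral>\<^sup>+ q. ennreal ((norm (pgrad own i (\<lambda>z. \<psi> i z (\<xi> q)) x))\<^sup>2) \<partial>Q) \<le> ennreal (m\<^sup>2))"

definition weighted_potential ::
  "('c::finite \<Rightarrow> 'i::finite) \<Rightarrow> ('i \<Rightarrow> (real ^ 'c) set) \<Rightarrow> ('i \<Rightarrow> real ^ 'c \<Rightarrow> real)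
     \<Rightarrow> ('i \<Rightarrow> real) \<Rightarrow> (real ^ 'c \<Rightarrow> real) \<Rightarrow> bool" where
  "weighted_potential own X f w P \<longleftrightarrow>
     (\<forall>i. w i > 0) \<and>
     (\<exists>U. open U \<and> profiles own X \<subseteq> U \<and> (\<forall>x\<in>U. P differentiable (at x)) \<and>
          continuous_on U (gradient P)) \<and>
     (\<forall>i. \<forall>x\<in>profiles own X. \<forall>y\<in>X i. \<forall>y'\<in>X i.
        P (upd own i y x) - P (upd own i y' x) =
          w i * (f i (upd own i y x) - f i (upd own i y' x)))"


text \<open>
  The samples drawn by a player in one iteration form a list, whose length may be random. The
  \<open>\<sigma>\<close>-algebra on lists is that of the disjoint union of the spaces \<open>'a^n\<close>; with \<open>A = UNIV\<close> the
  generators determine the length.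
\<close>

definition list_borel :: "'a::topological_space list measure" where
  "list_borel = sigma UNIV {{v. t < length v \<and> v ! t \<in> A} | t A. A \<in> sets borel}"

text \<open>
  Conditionally on \<open>F\<close> and on its length, the entries of the list \<open>s\<close> are independent and
  distributed like \<open>\<xi>\<close>.
\<close>

definition fresh_samples ::
  "'o measure \<Rightarrow> 'o measure \<Rightarrow> 'q measure \<Rightarrow> ('q \<Rightarrow> 'a::topological_space) \<Rightarrow> ('o \<Rightarrow> 'a list) \<Rightarrow> bool" where
  "fresh_samples M F Q \<xi> s \<longleftrightarrow>
     s \<in> M \<rightarrow>\<^sub>M list_borel \<and>
     (\<forall>E\<in>sets F. \<forall>n A. (\<forall>t<n. A t \<in> sets borel) \<longrightarrow>
        measure M {\<omega>\<in>E. length (s \<omega>) = n \<and> (\<forall>t<n. s \<omega> ! t \<in> A t)} =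
        measure M {\<omega>\<in>E. length (s \<omega>) = n} * (\<Prod>t<n. measure Q {q\<in>space Q. \<xi> q \<in> A t}))"

definition events :: "'o set \<Rightarrow> 'b measure \<Rightarrow> ('o \<Rightarrow> 'b) \<Rightarrow> 'o set set" where
  "events \<Omega> N Z = {Z -` A \<inter> \<Omega> | A. A \<in> sets N}"

text \<open>
  \<open>past\<close> is the \<open>\<sigma>\<close>-field \<open>\<F>'_k\<close>, and \<open>past_delays\<close> is \<open>\<F>_k\<close>. In between lies \<open>player_info i\<close>,
  the information behind the computation of \<open>T_i(y^i(k))\<close> before sampling: it contains the
  delays \<open>d_{ij}(k)\<close> of player \<open>i\<close> only. As \<open>\<F>'_{k+1}\<close> contains just the delays of the picked
  player, \<open>\<F>'_k\<close> is increasing in \<open>k\<close>, but \<open>\<F>_k\<close> need not be.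
\<close>

definition past ::
  "'o measure \<Rightarrow> (nat \<Rightarrow> 'o \<Rightarrow> real ^ 'c::finite) \<Rightarrow> (nat \<Rightarrow> 'o \<Rightarrow> 'i::finite)
     \<Rightarrow> ('i \<Rightarrow> nat \<Rightarrow> 'o \<Rightarrow> (real ^ 'd::finite) list) \<Rightarrow> ('i \<Rightarrow> 'i \<Rightarrow> nat \<Rightarrow> 'o \<Rightarrow> nat)
     \<Rightarrow> nat \<Rightarrow> 'o measure" where
  "past M x idx smp d k =
     sigma (space M)
       (events (space M) borel (x 0) \<union>
        (\<Union>l<k. events (space M) (count_space UNIV) (idx l) \<union>
               events (space M) list_borel (\<lambda>\<omega>. smp (idx l \<omega>) l \<omega>) \<union>
               (\<Union>j. events (space M) (count_space UNIV) (\<lambda>\<omega>. d (idx l \<omega>) j l \<omega>))))"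

definition player_info ::
  "'o measure \<Rightarrow> (nat \<Rightarrow> 'o \<Rightarrow> real ^ 'c::finite) \<Rightarrow> (nat \<Rightarrow> 'o \<Rightarrow> 'i::finite)
     \<Rightarrow> ('i \<Rightarrow> nat \<Rightarrow> 'o \<Rightarrow> (real ^ 'd::finite) list) \<Rightarrow> ('i \<Rightarrow> 'i \<Rightarrow> nat \<Rightarrow> 'o \<Rightarrow> nat)
     \<Rightarrow> 'i \<Rightarrow> nat \<Rightarrow> 'o measure" where
  "player_info M x idx smp d i k =
     sigma (space M)
       (sets (past M x idx smp d k) \<union>
        (\<Union>j. events (space M) (count_space UNIV) (d i j k)))"

definition past_delays ::
  "'o measure \<Rightarrow> (nat \<Rightarrow> 'o \<Rightarrow> real ^ 'c::finite) \<Rightarrow> (nat \<Rightarrow> 'o \<Rightarrow> 'i::finite)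
     \<Rightarrow> ('i \<Rightarrow> nat \<Rightarrow> 'o \<Rightarrow> (real ^ 'd::finite) list) \<Rightarrow> ('i \<Rightarrow> 'i \<Rightarrow> nat \<Rightarrow> 'o \<Rightarrow> nat)
     \<Rightarrow> nat \<Rightarrow> 'o measure" where
  "past_delays M x idx smp d k =
     sigma (space M)
       (sets (past M x idx smp d k) \<union>
        (\<Union>i. \<Union>j. events (space M) (count_space UNIV) (d i j k)))"

text \<open>
  The delayed vector \<open>y^i(k)\<close>. Truncated subtraction on \<open>nat\<close> realises the convention
  \<open>x(l) = x(0)\<close> for \<open>l < 0\<close>.
\<close>

definition delayed ::
  "('c::finite \<Rightarrow> 'i) \<Rightarrow> (nat \<Rightarrow> 'o \<Rightarrow> real ^ 'c) \<Rightarrow> ('i \<Rightarrow> 'i \<Rightarrow> nat \<Rightarrow> 'o \<Rightarrow> nat)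
     \<Rightarrow> 'i \<Rightarrow> nat \<Rightarrow> 'o \<Rightarrow> real ^ 'c" where
  "delayed own x d i k \<omega> = (\<chi> c. x (k - d i (own c) k \<omega>) \<omega> $ c)"

text \<open>
  The stochastic approximation routine computing \<open>T_i(y^i(k))\<close> is not fixed: its error
  \<open>\<epsilon> i (Suc k)\<close> is any function of \<open>player_info i\<close> and the list \<open>smp i k\<close> of fresh samples,
  whose length is decided by \<open>player_info i\<close>. The errors are defined for every player at every
  iteration, but enter the iterates only when \<open>i\<close> is picked.
\<close>

definition async_scheme ::
  "('c::finite \<Rightarrow> 'i::finite) \<Rightarrow> ('i \<Rightarrow> (real ^ 'c) set) \<Rightarrow> ('i \<Rightarrow> real ^ 'c \<Rightarrow> real)
     \<Rightarrow> ('i \<Rightarrow> real) \<Rightarrow> 'q measure \<Rightarrow> ('q \<Rightarrow> real ^ 'd::finite) \<Rightarrow> 'o measure \<Rightarrow> ('i \<Rightarrow> real)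
     \<Rightarrow> (nat \<Rightarrow> 'o \<Rightarrow> real ^ 'c) \<Rightarrow> (nat \<Rightarrow> 'o \<Rightarrow> 'i)
     \<Rightarrow> ('i \<Rightarrow> nat \<Rightarrow> 'o \<Rightarrow> (real ^ 'd) list) \<Rightarrow> ('i \<Rightarrow> 'i \<Rightarrow> nat \<Rightarrow> 'o \<Rightarrow> nat)
     \<Rightarrow> ('i \<Rightarrow> nat \<Rightarrow> 'o \<Rightarrow> real ^ 'c) \<Rightarrow> bool" where
  "async_scheme own X f \<mu> Q \<xi> M p x idx smp d \<epsilon> \<longleftrightarrow>
     prob_space M \<and>
     (\<forall>i. 0 < p i \<and> p i < 1) \<and> (\<Sum>i\<in>UNIV. p i) = 1 \<and>
     (\<forall>k. idx k \<in> M \<rightarrow>\<^sub>M count_space UNIV \<and>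
        (\<forall>i. measure M {\<omega>\<in>space M. idx k \<omega> = i} = p i)) \<and>
     (\<forall>i k. fresh_samples M (past_delays M x idx smp d k) Q \<xi> (smp i k) \<and>
        (\<lambda>\<omega>. length (smp i k \<omega>)) \<in> player_info M x idx smp d i k \<rightarrow>\<^sub>M count_space UNIV) \<and>
     (\<forall>i j k. d i j k \<in> M \<rightarrow>\<^sub>M count_space UNIV) \<and>
     (\<forall>i k. \<forall>\<omega>\<in>space M. d i i k \<omega> = 0) \<and>
     (\<forall>i k. \<epsilon> i (Suc k) \<in> borel_measurable (sigma (space M)
          (sets (player_info M x idx smp d i k) \<union> events (space M) list_borel (smp i k))) \<and>
        (\<forall>\<omega>\<in>space M. \<epsilon> i (Suc k) \<omega> \<in> block own i)) \<and>
     x 0 \<in> borel_measurable M \<and> (\<forall>\<omega>\<in>space M. x 0 \<omega> \<in> profiles own X) \<and>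
     (\<forall>k. \<forall>\<omega>\<in>space M. \<forall>i.
        (if idx k \<omega> = i
         then proj own i (x (Suc k) \<omega>) = prox own X f \<mu> i (delayed own x d i k \<omega>) + \<epsilon> i (Suc k) \<omega> \<and>
              proj own i (x (Suc k) \<omega>) \<in> X i
         else proj own i (x (Suc k) \<omega>) = proj own i (x k \<omega>)))"

definition assumption_A3 ::
  "'o measure \<Rightarrow> (nat \<Rightarrow> 'o \<Rightarrow> real ^ 'c::finite) \<Rightarrow> (nat \<Rightarrow> 'o \<Rightarrow> 'i::finite)
     \<Rightarrow> ('i \<Rightarrow> nat \<Rightarrow> 'o \<Rightarrow> (real ^ 'd::finite) list) \<Rightarrow> ('i \<Rightarrow> 'i \<Rightarrow> nat \<Rightarrow> 'o \<Rightarrow> nat)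
     \<Rightarrow> ('i \<Rightarrow> nat \<Rightarrow> 'o \<Rightarrow> real ^ 'c) \<Rightarrow> nat \<Rightarrow> bool" where
  "assumption_A3 M x idx smp d \<epsilon> \<tau> \<longleftrightarrow>
     (\<forall>k\<ge>1. prob_space.indep_set M
        (events (space M) (count_space UNIV) (idx k)) (sets (past_delays M x idx smp d k))) \<and>
     (\<forall>i. AE \<omega> in M.
        (\<Sum>k. nn_cond_exp M (past_delays M x idx smp d (Suc k))
               (\<lambda>\<omega>. ennreal ((norm (\<epsilon> i (Suc (Suc k)) \<omega>))\<^sup>2)) \<omega>) < \<infinity>) \<and>
     (\<forall>i. AE \<omega> in M.
        (\<Sum>k. nn_cond_exp M (past_delays M x idx smp d (Suc k))
               (\<lambda>\<omega>. ennreal (norm (\<epsilon> i (Suc (Suc k)) \<omega>))) \<omega>) < \<infinity>) \<and>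
     0 < \<tau> \<and> (\<forall>i j k. \<forall>\<omega>\<in>space M. d i j k \<omega> \<le> \<tau>)"

end

theory Submission
  imports Defs
begin

text \<open>
  Along a single trajectory the scheme is an inexact, delayed block descent on the potential \<open>P\<close>,
  and randomness enters only through summability of the errors and through the fact that every
  player keeps being picked.

  Write \<open>h_i(k) = T_i(y^i(k)) - x_i(k)\<close>. As \<open>d_{ii} = 0\<close>, optimality of the proximal step gives
  \<open>\<nabla>_i f_i(y^i(k)) \<bullet> h_i(k) \<le> - \<mu>_i |h_i(k)|\<^sup>2\<close>, and the Lipschitz gradient turns this into
  \<open>P(x(k+1)) - P(x(k)) \<le> - w_i (\<mu>_i - L_i/2) |h_i(k)|\<^sup>2 + w_i L_i |x(k) - y^i(k)| |h_i(k)| + C |\<epsilon>|\<close>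
  for the picked \<open>i\<close> (\<open>potential_step\<close>). The square of the delay error is at most \<open>\<tau>\<close> times the sum of
  the last \<open>\<tau>\<close> squared steps, and each step is \<open>h\<close> plus an error. Young's inequality with weight
  \<open>A = L_ave w_ave\<close> splits the cross term so that, summed over time, the delays cost at most
  \<open>\<tau>/2 (A + (w_i L_i)\<^sup>2 / A)\<close> per squared residual. The lower bound on \<open>\<mu>_i\<close> leaves a positive margin
  over this cost. Hence, whenever the errors that enter the iterates have a finite sum, so do the
  squared residuals \<open>|h_i(k)|\<^sup>2\<close> of the picked players (\<open>picked_residuals_summable\<close>). This is a
  statement about every single path; no supermartingale is used.

  The probabilistic part has to cope with the fact that the \<sigma>-fields \<open>\<F>_k\<close>, on which the
  errors are conditioned, need not increase with \<open>k\<close>: the delays of players that were not picked are forgotten. The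
  fields \<open>\<F>'_k\<close> do increase. Fresh samples are independent of \<open>\<F>_k\<close>, so the conditional expectation
  of \<open>|\<epsilon>_i(k+1)|\<close> depends on the information of player \<open>i\<close> only (\<open>cond_exp_fresh_samples\<close>), and on the
  event \<open>i_k = i\<close> that information belongs to \<open>\<F>'_{k+1}\<close> (\<open>sample_trace\<close>). A stopping argument
  (\<open>summable_transfer\<close>, packaged as \<open>summable_if_picked\<close>) then moves almost sure summability from the
  times at which \<open>i\<close> is picked to all times, because \<open>i_k\<close> is independent of the information of
  player \<open>i\<close>. It is applied twice: to the conditional expectations, which gives
  \<open>\<Sum>|\<epsilon>_i(k)| < \<infinity>\<close>, and to the squared residuals, which gives \<open>\<Sum>|h_i(k)|\<^sup>2 < \<infinity>\<close> for every \<open>i\<close>.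

  Finally \<open>G(x(k))\<close> is bounded by residuals and delay errors (\<open>gap_le_residuals\<close>), so it tends to \<open>0\<close>.
  As \<open>G\<close> is continuous and vanishes only at Nash equilibria, limit points are equilibria;
  steps tending to \<open>0\<close> make the limit set connected; and dominated convergence gives the statement on
  expectations.
\<close>

section \<open>Blocks of coordinates\<close>

lemma proj_nth [simp]: "proj own i x $ c = (if own c = i then x $ c else 0)"
  by (simp add: proj_def)

lemma upd_nth [simp]: "upd own i y x $ c = (if own c = i then y $ c else x $ c)"
  by (simp add: upd_def)

lemma proj_block: "v \<in> block own i \<Longrightarrow> proj own i v = v"
  by (auto simp: vec_eq_iff block_def)

lemma proj_diff: "proj own i (x - y) = proj own i x - proj own i y"
  by (auto simp: vec_eq_iff)

lemma proj_upd: "proj own j (upd own i y x) = (if j = i then proj own i y else proj own j x)"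
  by (auto simp: vec_eq_iff)

lemma upd_proj_self [simp]: "upd own i (proj own i x) x = x"
  by (auto simp: vec_eq_iff)

lemma upd_upd [simp]: "upd own i z (upd own i y x) = upd own i z x"
  by (auto simp: vec_eq_iff)

lemma upd_diff:
  assumes "a \<in> block own i" "b \<in> block own i"
  shows "upd own i a x - upd own i b x = a - b"
  using assms by (auto simp: vec_eq_iff block_def)

lemma sum_proj:
  fixes own :: "'c::finite \<Rightarrow> 'i::finite"
  shows "(\<Sum>i\<in>UNIV. proj own i x) = x"
  by (auto simp: vec_eq_iff)

lemma norm_square_vec: "(norm x)\<^sup>2 = (\<Sum>c\<in>UNIV. (x $ c)\<^sup>2)" for x :: "real ^ 'c::finite"
  unfolding power2_norm_eq_inner inner_vec_def by (simp add: power2_eq_square)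

lemma norm_square_proj:
  fixes own :: "'c::finite \<Rightarrow> 'i::finite"
  shows "(norm x)\<^sup>2 = (\<Sum>i\<in>UNIV. (norm (proj own i x))\<^sup>2)"
proof -
  have "(\<Sum>i\<in>UNIV. (norm (proj own i x))\<^sup>2)
      = (\<Sum>c\<in>UNIV. \<Sum>i\<in>UNIV. if own c = i then (x $ c)\<^sup>2 else 0)"
    unfolding norm_square_vec by (subst sum.swap) (auto intro!: sum.cong)
  then show ?thesis
    unfolding norm_square_vec by simp
qed

lemma norm_proj_le:
  fixes own :: "'c::finite \<Rightarrow> 'i::finite"
  shows "norm (proj own i x) \<le> norm x"
proof (rule power2_le_imp_le)
  show "(norm (proj own i x))\<^sup>2 \<le> (norm x)\<^sup>2"
    unfolding norm_square_proj[of x own] by (rule member_le_sum) auto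
qed simp

lemma continuous_on_proj: "continuous_on S (proj own i)"
proof -
  have "continuous_on S (\<lambda>x. if own c = i then x $ c else 0)" for c
    by (cases "own c = i") (auto intro!: continuous_intros)
  then show ?thesis
    unfolding proj_def by (rule continuous_on_vec_lambda)
qed

lemma profilesD: "x \<in> profiles own X \<Longrightarrow> proj own i x \<in> X i"
  by (auto simp: profiles_def)

section \<open>Gradients\<close>

lemma gradient_eqI:
  fixes F :: "'a::euclidean_space \<Rightarrow> real"
  assumes "(F has_derivative (\<lambda>h. D \<bullet> h)) (at x)"
  shows "gradient F x = D"
  unfolding gradient_def
proof (rule the_equality)
  show "GDERIV F x :> D"
    using assms unfolding gderiv_def by (subst inner_commute)
next
  fix D' assume "GDERIV F x :> D'"
  then have "(F has_derivative (\<lambda>h. h \<bullet> D')) (at x)"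
    by (simp add: gderiv_def)
  from fun_cong[OF has_derivative_unique[OF this assms]] have "h \<bullet> D' = D \<bullet> h" for h .
  then show "D' = D"
    by (metis inner_commute vector_eq_ldot)
qed

lemma has_derivative_gradient:
  fixes F :: "'a::euclidean_space \<Rightarrow> real"
  assumes "F differentiable (at x)"
  shows "(F has_derivative (\<lambda>h. gradient F x \<bullet> h)) (at x)"
proof -
  obtain F' where F': "(F has_derivative F') (at x)"
    using assms by (auto simp: differentiable_def)
  interpret F': linear F'
    by (rule has_derivative_linear[OF F'])
  define D where "D = (\<Sum>b\<in>Basis. F' b *\<^sub>R b)"
  have "F' h = D \<bullet> h" for h
  proof -
    have "F' h = F' (\<Sum>b\<in>Basis. (h \<bullet> b) *\<^sub>R b)"
      by (simp add: euclidean_representation)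
    also have "\<dots> = D \<bullet> h"
      by (simp add: F'.sum F'.scale D_def inner_sum_left, intro sum.cong)
         (simp_all add: inner_commute mult.commute)
    finally show ?thesis .
  qed
  then have "F' = (\<lambda>h. D \<bullet> h)" by auto
  with F' have "(F has_derivative (\<lambda>h. D \<bullet> h)) (at x)" by simp
  with gradient_eqI[OF this] show ?thesis by simp
qed

text \<open>
  Gradients are two-sided derivatives, but feasible segments start at their base point. One-sided
  information on \<open>[0, 1]\<close> still fixes the sign of the derivative at \<open>0\<close>, which is all that the
  variational inequalities below use.
\<close>

lemma deriv_nonneg_at_left_end:
  fixes \<phi> :: "real \<Rightarrow> real"
  assumes "(\<phi> has_real_derivative D) (at 0)" and "\<And>t. 0 \<le> t \<Longrightarrow> t \<le> 1 \<Longrightarrow> \<phi> 0 \<le> \<phi> t"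
  shows "0 \<le> D"
proof (rule ccontr)
  assume "\<not> 0 \<le> D"
  then obtain e where "e > 0" "\<And>h. 0 < h \<Longrightarrow> h < e \<Longrightarrow> \<phi> (0 + h) < \<phi> 0"
    using DERIV_neg_dec_right[OF assms(1)] by auto
  from this(2)[of "min (e/2) 1"] this(1) assms(2)[of "min (e/2) 1"] show False
    by (auto simp: min_less_iff_disj)
qed

section \<open>Limit sets of sequences with vanishing steps\<close>

text \<open>
  A sequence in a compact set is attracted by its limit set. If that set split into two compact
  parts at distance \<open>e\<close>, the sequence would have to cross a gap of width \<open>e/2\<close> infinitely often,
  which vanishing steps forbid.
\<close>

lemma limit_set_connected_attracting:
  fixes x :: "nat \<Rightarrow> 'a::euclidean_space"
  assumes K: "compact K" "\<And>k. x k \<in> K"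
    and steps: "(\<lambda>k. x (Suc k) - x k) \<longlonglongrightarrow> 0"
  defines "C \<equiv> {z. \<exists>r. strict_mono r \<and> (\<lambda>n. x (r n)) \<longlonglongrightarrow> z}"
  shows "C \<noteq> {} \<and> connected C \<and> (\<lambda>k. infdist (x k) C) \<longlonglongrightarrow> 0"
proof -
  have cluster: "\<exists>z\<in>C. \<exists>q. strict_mono q \<and> (\<lambda>n. x (r (q n))) \<longlonglongrightarrow> z" if "strict_mono r" for r :: "nat \<Rightarrow> nat"
  proof -
    obtain z q where "strict_mono q" "(\<lambda>n. x (r (q n))) \<longlonglongrightarrow> z"
      using compact_imp_seq_compact[OF K(1), unfolded seq_compact_def, rule_format, of "\<lambda>n. x (r n)"] K(2)
      by (auto simp: o_def)
    moreover from this have "z \<in> C"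
      unfolding C_def using strict_mono_o[OF that \<open>strict_mono q\<close>] by (auto simp: o_def)
    ultimately show ?thesis by blast
  qed
  have nonempty: "C \<noteq> {}"
    using cluster[of id] by (auto simp: strict_mono_id)
  have closedC: "C = (\<Inter>n. closure (x ` {n..}))"
  proof (intro equalityI subsetI)
    fix z assume "z \<in> C"
    then obtain r where r: "strict_mono r" "(\<lambda>n. x (r n)) \<longlonglongrightarrow> z" by (auto simp: C_def)
    have "z \<in> closure (x ` {n..})" for n
      unfolding closure_sequential
      by (rule exI[of _ "\<lambda>m. x (r (m + n))"])
         (use LIMSEQ_ignore_initial_segment[OF r(2), of n] r(1) in
          \<open>auto intro!: imageI intro: order_trans[OF _ seq_suble]\<close>)
    then show "z \<in> (\<Inter>n. closure (x ` {n..}))" by auto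
  next
    fix z assume z: "z \<in> (\<Inter>n. closure (x ` {n..}))"
    have near: "\<exists>k\<ge>n. dist (x k) z < e" if "e > 0" for e n
    proof -
      have "z \<in> closure (x ` {n..})" using z by auto
      then show ?thesis using that by (auto simp: closure_approachable)
    qed
    define r where "r = rec_nat (SOME k. dist (x k) z < 1)
      (\<lambda>n m. SOME k. m < k \<and> dist (x k) z < 1 / real (Suc (Suc n)))"
    have r_Suc: "r n < r (Suc n) \<and> dist (x (r (Suc n))) z < 1 / real (Suc (Suc n))" for n
    proof -
      have "\<exists>k. r n < k \<and> dist (x k) z < 1 / real (Suc (Suc n))"
        using near[of "1 / real (Suc (Suc n))" "Suc (r n)"] by (auto simp: Suc_le_eq)
      from someI_ex[OF this] show ?thesis by (simp add: r_def)
    qed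
    have "dist (x (r n)) z < 1 / real (Suc n)" for n
    proof (cases n)
      case 0
      have "\<exists>k. dist (x k) z < 1" using near[of 1 0] by auto
      from someI_ex[OF this] show ?thesis using 0 by (simp add: r_def)
    qed (use r_Suc in simp)
    then have "(\<lambda>n. x (r n)) \<longlonglongrightarrow> z"
      unfolding tendsto_dist_iff[of _ z]
      by (intro tendsto_sandwich[OF _ _ tendsto_const lim_1_over_n[THEN LIMSEQ_Suc]])
         (auto intro!: always_eventually less_imp_le)
    moreover have "strict_mono r" using r_Suc by (simp add: strict_mono_Suc_iff)
    ultimately show "z \<in> C" by (auto simp: C_def)
  qed
  have attract: "(\<lambda>k. infdist (x k) C) \<longlonglongrightarrow> 0"
  proof (rule ccontr)
    assume "\<not> (\<lambda>k. infdist (x k) C) \<longlonglongrightarrow> 0"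
    then obtain e where e: "e > 0" "\<exists>\<^sub>F k in sequentially. infdist (x k) C \<ge> e"
      by (auto simp: tendsto_iff infdist_nonneg not_eventually not_less)
    then have "infinite {k. infdist (x k) C \<ge> e}"
      by (simp add: cofinite_eq_sequentially[symmetric] frequently_cofinite)
    then obtain r :: "nat \<Rightarrow> nat" where r: "strict_mono r" "\<And>n. infdist (x (r n)) C \<ge> e"
      using infinite_enumerate[of "{k. infdist (x k) C \<ge> e}"] by blast
    obtain z q where zq: "z \<in> C" "(\<lambda>n. x (r (q n))) \<longlonglongrightarrow> z"
      using cluster[OF r(1)] by blast
    then have "(\<lambda>n. infdist (x (r (q n))) C) \<longlonglongrightarrow> infdist z C"
      by (intro tendsto_infdist)
    moreover have "infdist z C = 0" using zq(1) by simp
    ultimately have "e \<le> 0"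
      by (intro LIMSEQ_le_const[of "\<lambda>n. infdist (x (r (q n))) C"]) (use r(2) in auto)
    with e show False by simp
  qed
  have "connected C"
  proof (rule ccontr)
    assume "\<not> connected C"
    moreover have "closed C" by (subst closedC) auto
    moreover have "C \<subseteq> K"
      unfolding C_def by (auto intro: closed_sequentially[OF compact_imp_closed[OF K(1)] K(2)])
    ultimately have "compact C"
      using compact_Int_closed[OF K(1), of C] by (simp add: inf.absorb2)
    have "\<exists>A B. closed A \<and> closed B \<and> A \<noteq> {} \<and> B \<noteq> {} \<and> A \<union> B = C \<and> A \<inter> B = {}"
      using \<open>\<not> connected C\<close> unfolding connected_closed_set[OF \<open>closed C\<close>] not_not .
    then obtain A B where AB: "closed A" "closed B" "A \<noteq> {}" "B \<noteq> {}" "A \<union> B = C" "A \<inter> B = {}"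
      by (elim exE conjE) (rule that)
    have "C \<inter> A = A" using AB(5) by blast
    then have "compact A"
      using compact_Int_closed[OF \<open>compact C\<close> AB(1)] by simp
    then obtain e where e: "e > 0" "\<And>a b. a \<in> A \<Longrightarrow> b \<in> B \<Longrightarrow> e \<le> dist a b"
      using separate_compact_closed[OF _ AB(2,6)] by metis
    \<comment> \<open>Late iterates lie within \<open>e/4\<close> of exactly one of \<open>A\<close> and \<open>B\<close>, and steps shorter than \<open>e/4\<close>
      cannot change which one.\<close>
    have "\<forall>\<^sub>F k in sequentially. infdist (x k) C < e/4"
      using order_tendstoD(2)[OF attract, of "e/4"] e(1) by simp
    moreover
    have "\<forall>\<^sub>F k in sequentially. norm (x (Suc k) - x k) < e/4"
      using order_tendstoD(2)[OF tendsto_norm_zero[OF steps], of "e/4"] e(1) by simp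
    ultimately have "\<forall>\<^sub>F k in sequentially. infdist (x k) C < e/4 \<and> norm (x (Suc k) - x k) < e/4"
      by (rule eventually_conj)
    then obtain n where n: "\<And>k. k \<ge> n \<Longrightarrow> infdist (x k) C < e/4 \<and> norm (x (Suc k) - x k) < e/4"
      unfolding eventually_sequentially by blast
    have close: "\<exists>c\<in>C. dist (x k) c < e/4" if "k \<ge> n" for k
    proof -
      have "(INF c\<in>C. dist (x k) c) < e/4"
        using n[OF that] nonempty by (simp add: infdist_notempty)
      from cInf_lessD[OF _ this] nonempty show ?thesis by auto
    qed
    have stay: "\<exists>a\<in>A. dist (x k) a < e/4" if mn: "m \<ge> n" and "k \<ge> m" "\<exists>a\<in>A. dist (x m) a < e/4" for m k
      using that(2,3)
    proof (induction k rule: dec_induct)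
      case (step k)
      then obtain a where a: "a \<in> A" "dist (x k) a < e/4" by auto
      obtain c where c: "c \<in> C" "dist (x (Suc k)) c < e/4"
        using close[of "Suc k"] step(1) mn by auto
      have "dist a c \<le> dist (x k) a + (dist (x k) (x (Suc k)) + dist (x (Suc k)) c)"
        using dist_triangle[of a c "x k"] dist_triangle[of "x k" c "x (Suc k)"]
        by (simp add: dist_commute)
      also have "\<dots> < e" using a c e(1) n[of k] step(1) mn by (simp add: dist_norm norm_minus_commute)
      finally have "dist a c < e" .
      then have "c \<in> A" using e(2)[of a c] a(1) c(1) AB(5) by auto
      then show ?case using c by auto
    qed auto
    have visit: "\<exists>k\<ge>m. dist (x k) a < e/4" if "a \<in> C" for a m
    proof -
      have "a \<in> closure (x ` {m..})" using that closedC by auto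
      then show ?thesis using e(1) by (auto simp: closure_approachable elim!: allE[of _ "e/4"])
    qed
    obtain a b where a: "a \<in> A" and b: "b \<in> B" using AB by auto
    obtain m where m: "m \<ge> n" "dist (x m) a < e/4" using visit a AB(5) by blast
    obtain k where k: "k \<ge> m" "dist (x k) b < e/4" using visit b AB(5) by blast
    obtain a' where a': "a' \<in> A" "dist (x k) a' < e/4" using stay[OF m(1) k(1)] a m by auto
    have "dist a' b < e"
      using a'(2) k(2) dist_triangle3[of a' b "x k"] e(1) by linarith
    with e(2)[OF a'(1) b] show False by simp
  qed
  with nonempty attract show ?thesis by simp
qed

section \<open>Descent with delays\<close>

text \<open>
  Truncating at \<open>1\<close> does not affect summability, since the terms of a convergent series are
  eventually below \<open>1\<close>. The truncation makes the stopping argument of \<open>summable_transfer\<close>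
  applicable to unbounded errors.
\<close>

lemma suminf_min_one_finite_imp_summable:
  fixes a :: "nat \<Rightarrow> real"
  assumes a: "\<And>k. 0 \<le> a k" and fin: "(\<Sum>k. min (ennreal (a k)) 1) < \<infinity>"
  shows "summable a"
proof -
  have "min (ennreal (a k)) 1 = ennreal (min (a k) 1)" for k
    by (simp add: min_def ennreal_1[symmetric] del: ennreal_1)
  with fin have s: "summable (\<lambda>k. min (a k) 1)"
    using a by (intro summable_suminf_not_top) auto
  have "\<forall>\<^sub>F k in sequentially. min (a k) 1 < 1"
    using order_tendstoD(2)[OF summable_LIMSEQ_zero[OF s], of 1] by simp
  then have "\<forall>\<^sub>F k in sequentially. min (a k) 1 = a k"
    by eventually_elim auto
  from summable_cong[OF this] s show ?thesis by simp
qed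

text \<open>
  Every index \<open>l\<close> lies in at most \<open>\<tau>\<close> of the windows \<open>{k - \<tau>..<k}\<close>.
\<close>

lemma sum_windows_le:
  fixes s :: "nat \<Rightarrow> real"
  assumes "\<And>l. 0 \<le> s l"
  shows "(\<Sum>k<n. \<Sum>l\<in>{k-\<tau>..<k}. s l) \<le> real \<tau> * (\<Sum>l<n. s l)"
proof -
  have "(\<Sum>k<n. \<Sum>l\<in>{k-\<tau>..<k}. s l) = (\<Sum>k<n. \<Sum>l<n. if k - \<tau> \<le> l \<and> l < k then s l else 0)"
    by (intro sum.cong refl sum.mono_neutral_cong_left) auto
  also have "\<dots> = (\<Sum>l<n. \<Sum>k<n. if k - \<tau> \<le> l \<and> l < k then s l else 0)"
    by (rule sum.swap)
  also have "\<dots> \<le> (\<Sum>l<n. real \<tau> * s l)"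
  proof (rule sum_mono)
    fix l
    have "(\<Sum>k<n. if k - \<tau> \<le> l \<and> l < k then s l else 0) \<le> (\<Sum>k\<in>{l<..l+\<tau>}. s l)"
      by (subst sum.inter_filter[symmetric], simp, rule sum_mono2) (auto simp: assms)
    then show "(\<Sum>k<n. if k - \<tau> \<le> l \<and> l < k then s l else 0) \<le> real \<tau> * s l" by simp
  qed
  finally show ?thesis by (simp add: sum_distrib_left)
qed

text \<open>
  Telescoping. The delayed sums contribute at most \<open>c \<tau> \<Sum>s\<close>, hence \<open>c \<tau> \<Sum>H\<close> up to a multiple of
  the errors, which is exactly what the decrease provides beyond the margin \<open>\<eta>\<close>.
\<close>

lemma summable_of_delayed_descent:
  fixes V H s e :: "nat \<Rightarrow> real"
  assumes bdd: "\<And>k. m \<le> V k" and nonneg: "\<And>k. 0 \<le> H k" "\<And>k. 0 \<le> s k" and "0 < \<eta>" "0 \<le> c"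
    and descent: "\<And>k. V (Suc k) + (c * real \<tau> + \<eta>) * H k \<le> V k + c * (\<Sum>l\<in>{k-\<tau>..<k}. s l) + C * e k"
    and s_le: "\<And>k. s k \<le> H k + C' * e k"
    and e: "summable e" "\<And>k. 0 \<le> e k" "0 \<le> C" "0 \<le> C'"
  shows "summable H"
proof (rule summableI_nonneg_bounded)
  fix n
  let ?E = "suminf e"
  have "V n + (c * real \<tau> + \<eta>) * (\<Sum>k<n. H k)
     \<le> V 0 + c * (\<Sum>k<n. \<Sum>l\<in>{k-\<tau>..<k}. s l) + C * (\<Sum>k<n. e k)"
  proof (induction n)
    case (Suc n)
    with descent[of n] show ?case by (simp add: algebra_simps)
  qed simp
  also have "c * (\<Sum>k<n. \<Sum>l\<in>{k-\<tau>..<k}. s l) \<le> c * (real \<tau> * (\<Sum>l<n. s l))"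
    by (intro mult_left_mono sum_windows_le nonneg assms)
  also have "(\<Sum>l<n. s l) \<le> (\<Sum>l<n. H l) + C' * (\<Sum>l<n. e l)"
    using sum_mono[of "{..<n}" s "\<lambda>l. H l + C' * e l"] s_le
    by (simp add: sum.distrib sum_distrib_left)
  finally have "V n + (c * real \<tau> + \<eta>) * (\<Sum>k<n. H k) \<le>
      V 0 + c * (real \<tau> * ((\<Sum>l<n. H l) + C' * (\<Sum>l<n. e l))) + C * (\<Sum>k<n. e k)"
    using \<open>0 \<le> c\<close> by (simp add: mult_left_mono)
  then have "\<eta> * (\<Sum>k<n. H k) \<le> V 0 - m + (c * real \<tau> * C' + C) * (\<Sum>k<n. e k)"
    using bdd[of n] by (simp add: algebra_simps)
  also have "\<dots> \<le> V 0 - m + (c * real \<tau> * C' + C) * ?E"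
    using e \<open>0 \<le> c\<close> by (intro add_left_mono mult_left_mono sum_le_suminf) auto
  finally show "(\<Sum>k<n. H k) \<le> (V 0 - m + (c * real \<tau> * C' + C) * ?E) / \<eta>"
    using \<open>0 < \<eta>\<close> by (simp add: field_simps)
qed (rule nonneg)

section \<open>Convex games with Lipschitz partial gradients\<close>

locale convex_game =
  fixes own :: "'c::finite \<Rightarrow> 'i::finite" and X :: "'i \<Rightarrow> (real ^ 'c) set"
    and f :: "'i \<Rightarrow> real ^ 'c \<Rightarrow> real" and L :: "'i \<Rightarrow> real"
  assumes X_block: "\<And>i. X i \<subseteq> block own i"
    and X_compact: "\<And>i. compact (X i)"
    and X_convex: "\<And>i. convex (X i)"
    and cost_convex:
      "\<And>i x. x \<in> profiles own X \<Longrightarrow> convex_on (X i) (\<lambda>y. f i (upd own i y x))"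
    and cost_differentiable: "\<And>i x y. x \<in> profiles own X \<Longrightarrow> y \<in> X i \<Longrightarrow>
        (\<lambda>z. f i (upd own i z x)) differentiable (at y)"
    and L_pos: "\<And>i. 0 < L i"
    and pgrad_lipschitz: "\<And>i x x'. x \<in> profiles own X \<Longrightarrow> x' \<in> profiles own X \<Longrightarrow>
        norm (pgrad own i (f i) x - pgrad own i (f i) x') \<le> L i * norm (x - x')"
begin

abbreviation \<G> :: "(real ^ 'c) set" where "\<G> \<equiv> profiles own X"
abbreviation g :: "'i \<Rightarrow> real ^ 'c \<Rightarrow> real ^ 'c" where "g i \<equiv> pgrad own i (f i)"

lemma upd_profiles: "x \<in> \<G> \<Longrightarrow> y \<in> X i \<Longrightarrow> upd own i y x \<in> \<G>"
  using X_block[of i] by (auto simp: profiles_def proj_upd proj_block)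

lemma norm_upd_diff: "a \<in> X i \<Longrightarrow> b \<in> X i \<Longrightarrow> norm (upd own i a x - upd own i b x) = norm (a - b)"
  using X_block by (subst upd_diff) auto

text \<open>
  \<open>pgrad\<close> differentiates at the full profile, whereas differentiability is assumed at the point \<open>y\<close> of
  the block. Both agree since the function ignores the other coordinates: translating by
  \<open>y - upd own i y x\<close> changes none of its values.
\<close>

lemma has_derivative_cost:
  assumes "x \<in> \<G>" "y \<in> X i"
  shows "((\<lambda>z. f i (upd own i z x)) has_derivative (\<lambda>h. g i (upd own i y x) \<bullet> h)) (at y)"
proof -
  let ?F = "\<lambda>z. f i (upd own i z x)" and ?u = "upd own i y x"
  have der: "(?F has_derivative (\<lambda>h. gradient ?F y \<bullet> h)) (at y)"
    by (rule has_derivative_gradient[OF cost_differentiable[OF assms]])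
  have tr: "((\<lambda>z. z + (y - ?u)) has_derivative (\<lambda>h. h)) (at ?u)"
    by (auto intro!: derivative_eq_intros)
  have "((\<lambda>z. ?F (z + (y - ?u))) has_derivative (\<lambda>h. gradient ?F y \<bullet> h)) (at ?u)"
    by (rule has_derivative_compose[OF tr, of ?F "\<lambda>h. gradient ?F y \<bullet> h", simplified]) (use der in simp)
  moreover have "upd own i (z + (y - ?u)) x = upd own i z x" for z
    by (auto simp: vec_eq_iff)
  ultimately have "(?F has_derivative (\<lambda>h. gradient ?F y \<bullet> h)) (at ?u)" by simp
  then have "gradient ?F ?u = gradient ?F y" by (rule gradient_eqI)
  then have "g i ?u = gradient ?F y" by (simp add: pgrad_def)
  with der show ?thesis by simp
qed

lemma continuous_on_cost: "x \<in> \<G> \<Longrightarrow> continuous_on (X i) (\<lambda>z. f i (upd own i z x))"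
  using has_derivative_cost
  by (meson continuous_at_imp_continuous_on has_derivative_continuous)

lemma segment_in: "a \<in> X i \<Longrightarrow> b \<in> X i \<Longrightarrow> 0 \<le> t \<Longrightarrow> t \<le> 1 \<Longrightarrow> a + t *\<^sub>R (b - a) \<in> X i"
  using convexD_alt[OF X_convex, of a i b t] by (simp add: algebra_simps)

lemma cost_line_derivative:
  assumes "x \<in> \<G>" "a \<in> X i" "b \<in> X i" "0 \<le> t" "t \<le> 1"
  shows "((\<lambda>t. f i (upd own i (a + t *\<^sub>R (b - a)) x)) has_real_derivative
           g i (upd own i (a + t *\<^sub>R (b - a)) x) \<bullet> (b - a)) (at t)"
proof -
  have "((\<lambda>t. a + t *\<^sub>R (b - a)) has_derivative (\<lambda>s. s *\<^sub>R (b - a))) (at t)"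
    by (auto intro!: derivative_eq_intros)
  from has_derivative_compose[OF this has_derivative_cost[OF assms(1) segment_in[OF assms(2-)]]]
  show ?thesis
    by (simp add: has_field_derivative_def mult.commute[of _ "_ \<bullet> _"])
qed

text \<open>
  On the segment, the chord of the convex function lies above its graph and both meet at the left end,
  so the chord has the larger slope there.
\<close>

lemma cost_above_tangent:
  assumes "x \<in> \<G>" "a \<in> X i" "b \<in> X i"
  shows "f i (upd own i a x) + g i (upd own i a x) \<bullet> (b - a) \<le> f i (upd own i b x)"
proof -
  define \<phi> where "\<phi> t = f i (upd own i (a + t *\<^sub>R (b - a)) x)" for t
  define \<psi> where "\<psi> t = t * (\<phi> 1 - \<phi> 0) - \<phi> t" for t
  have "(\<phi> has_real_derivative g i (upd own i a x) \<bullet> (b - a)) (at 0)"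
    unfolding \<phi>_def using cost_line_derivative[OF assms, of 0] by simp
  then have "(\<psi> has_real_derivative (\<phi> 1 - \<phi> 0) - g i (upd own i a x) \<bullet> (b - a)) (at 0)"
    unfolding \<psi>_def by (auto intro!: derivative_eq_intros)
  moreover have "\<psi> 0 \<le> \<psi> t" if "0 \<le> t" "t \<le> 1" for t
  proof -
    have "\<phi> t \<le> (1 - t) * \<phi> 0 + t * \<phi> 1"
      using convex_onD[OF cost_convex[OF assms(1)] that assms(2,3)]
      by (simp add: \<phi>_def algebra_simps)
    then show ?thesis by (simp add: \<psi>_def algebra_simps)
  qed
  ultimately have "0 \<le> (\<phi> 1 - \<phi> 0) - g i (upd own i a x) \<bullet> (b - a)"
    by (rule deriv_nonneg_at_left_end)
  then show ?thesis by (simp add: \<phi>_def)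
qed

lemma pgrad_monotone:
  assumes "x \<in> \<G>" "a \<in> X i" "b \<in> X i"
  shows "0 \<le> (g i (upd own i b x) - g i (upd own i a x)) \<bullet> (b - a)"
  using cost_above_tangent[OF assms] cost_above_tangent[OF assms(1,3,2)]
  by (simp add: inner_diff_left inner_diff_right)

text \<open>
  The descent lemma for functions with Lipschitz gradient, restricted to a feasible segment: the
  quadratic upper model minus the function has a nonnegative derivative along the segment.
\<close>

lemma cost_descent:
  assumes "x \<in> \<G>" "a \<in> X i" "b \<in> X i"
  shows "f i (upd own i b x) \<le> f i (upd own i a x) + g i (upd own i a x) \<bullet> (b - a) + L i / 2 * (norm (b - a))\<^sup>2"
proof -
  define \<phi> where "\<phi> t = f i (upd own i (a + t *\<^sub>R (b - a)) x)
    - t * (g i (upd own i a x) \<bullet> (b - a)) - L i / 2 * t\<^sup>2 * (norm (b - a))\<^sup>2" for t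
  define \<phi>' where "\<phi>' t = g i (upd own i (a + t *\<^sub>R (b - a)) x) \<bullet> (b - a)
    - g i (upd own i a x) \<bullet> (b - a) - L i * t * (norm (b - a))\<^sup>2" for t
  have "\<phi> 1 \<le> \<phi> 0"
  proof (rule DERIV_nonpos_imp_nonincreasing[of 0 1 \<phi>])
    fix t :: real assume t: "0 \<le> t" "t \<le> 1"
    have "(\<phi> has_real_derivative \<phi>' t) (at t)"
      unfolding \<phi>_def \<phi>'_def
      by (auto intro!: derivative_eq_intros cost_line_derivative assms t)
    moreover have "\<phi>' t \<le> 0"
    proof -
      let ?at = "a + t *\<^sub>R (b - a)"
      have "(g i (upd own i ?at x) - g i (upd own i a x)) \<bullet> (b - a)
         \<le> norm (g i (upd own i ?at x) - g i (upd own i a x)) * norm (b - a)"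
        by (rule norm_cauchy_schwarz)
      also have "\<dots> \<le> (L i * norm (upd own i ?at x - upd own i a x)) * norm (b - a)"
        by (intro mult_right_mono pgrad_lipschitz upd_profiles assms segment_in t) auto
      also have "\<dots> = L i * t * (norm (b - a))\<^sup>2"
        using norm_upd_diff[OF segment_in[OF assms(2,3) t] assms(2)] t
        by (simp add: power2_eq_square)
      finally show ?thesis by (simp add: \<phi>'_def inner_diff_left)
    qed
    ultimately show "\<exists>y. (\<phi> has_real_derivative y) (at t) \<and> y \<le> 0" by blast
  qed simp
  then show ?thesis by (simp add: \<phi>_def)
qed

lemma prox_minimises:
  fixes \<mu> :: "'i \<Rightarrow> real" and i :: 'i
  assumes "x \<in> \<G>"
  shows "prox own X f \<mu> i x \<in> X i"
    and "\<And>y. y \<in> X i \<Longrightarrow>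
      f i (upd own i (prox own X f \<mu> i x) x) + \<mu> i / 2 * (norm (prox own X f \<mu> i x - proj own i x))\<^sup>2
      \<le> f i (upd own i y x) + \<mu> i / 2 * (norm (y - proj own i x))\<^sup>2"
proof -
  let ?F = "\<lambda>y. f i (upd own i y x) + \<mu> i / 2 * (norm (y - proj own i x))\<^sup>2"
  have "continuous_on (X i) ?F"
    by (intro continuous_intros continuous_on_cost assms)
  moreover have "X i \<noteq> {}" using profilesD[OF assms] by auto
  ultimately obtain z where "z \<in> X i" "\<And>y. y \<in> X i \<Longrightarrow> ?F z \<le> ?F y"
    using continuous_attains_inf[OF X_compact] by blast
  then have "is_arg_min ?F (\<lambda>y. y \<in> X i) z"
    by (auto simp: is_arg_min_linorder)
  then have "is_arg_min ?F (\<lambda>y. y \<in> X i) (prox own X f \<mu> i x)"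
    unfolding prox_def arg_min_on_def arg_min_def by (rule someI)
  then show "prox own X f \<mu> i x \<in> X i"
    and "\<And>y. y \<in> X i \<Longrightarrow> ?F (prox own X f \<mu> i x) \<le> ?F y"
    by (auto simp: is_arg_min_linorder)
qed

text \<open>
  First-order condition for the minimiser, tested on the segment to any feasible \<open>v\<close>.
\<close>

lemma prox_variational:
  fixes \<mu> :: "'i \<Rightarrow> real" and i :: 'i
  assumes x: "x \<in> \<G>" and v: "v \<in> X i"
  defines "T \<equiv> prox own X f \<mu> i x"
  shows "0 \<le> (g i (upd own i T x) + \<mu> i *\<^sub>R (T - proj own i x)) \<bullet> (v - T)"
proof -
  note T = prox_minimises[OF x, where \<mu>=\<mu> and i=i, folded T_def]
  define \<phi> where "\<phi> t = f i (upd own i (T + t *\<^sub>R (v - T)) x) + \<mu> i / 2 *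
    (norm (T + t *\<^sub>R (v - T) - proj own i x))\<^sup>2" for t
  have "((\<lambda>t. (norm (T + t *\<^sub>R (v - T) - proj own i x))\<^sup>2) has_real_derivative
      2 * ((T - proj own i x) \<bullet> (v - T))) (at 0)"
    unfolding power2_norm_eq_inner has_field_derivative_def
    by (auto intro!: derivative_eq_intros simp: inner_commute algebra_simps)
  moreover have "((\<lambda>t. f i (upd own i (T + t *\<^sub>R (v - T)) x)) has_real_derivative
      g i (upd own i T x) \<bullet> (v - T)) (at 0)"
    using cost_line_derivative[OF x T(1) v, of 0] by simp
  ultimately have "(\<phi> has_real_derivative
     g i (upd own i T x) \<bullet> (v - T) + \<mu> i / 2 * (2 * ((T - proj own i x) \<bullet> (v - T)))) (at 0)"
    unfolding \<phi>_def by (intro DERIV_add DERIV_cmult)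
  then have "0 \<le> g i (upd own i T x) \<bullet> (v - T) + \<mu> i / 2 * (2 * ((T - proj own i x) \<bullet> (v - T)))"
    by (rule deriv_nonneg_at_left_end)
       (use T(2)[OF segment_in[OF T(1) v]] in \<open>simp add: \<phi>_def\<close>)
  then show ?thesis by (simp add: inner_add_left)
qed

text \<open>
  Testing the variational inequality at \<open>x_i\<close> itself gives the bound with the gradient taken at the
  new point; monotonicity moves it back to \<open>x\<close>.
\<close>

lemma prox_decrease:
  fixes \<mu> :: "'i \<Rightarrow> real" and i :: 'i
  assumes x: "x \<in> \<G>" 
  defines "h \<equiv> prox own X f \<mu> i x - proj own i x"
  shows "g i x \<bullet> h \<le> - \<mu> i * (norm h)\<^sup>2"
proof -
  let ?T = "prox own X f \<mu> i x"
  note T = prox_minimises[OF x, where \<mu>=\<mu> and i=i] and p = profilesD[OF x, of i]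
  have "0 \<le> (g i (upd own i ?T x) + \<mu> i *\<^sub>R h) \<bullet> (- h)"
    using prox_variational[OF x p, where \<mu>=\<mu>] by (simp add: h_def)
  moreover have "0 \<le> (g i (upd own i ?T x) - g i x) \<bullet> h"
    using pgrad_monotone[OF x p T(1)] by (simp add: h_def)
  ultimately show ?thesis
    by (simp add: inner_add_left inner_diff_left power2_norm_eq_inner)
qed

text \<open>
  Add the variational inequalities of the two points, each tested at the other minimiser: the
  quadratic term makes the sum strongly monotone in the minimisers, and the parameter enters through
  a Lipschitz gradient.
\<close>

lemma prox_lipschitz:
  fixes \<mu> :: "'i \<Rightarrow> real" and i :: 'i
  assumes x: "x \<in> \<G>" and y: "y \<in> \<G>" and \<mu>: "0 < \<mu> i"
  shows "norm (prox own X f \<mu> i x - prox own X f \<mu> i y) \<le> (\<mu> i + L i) / \<mu> i * norm (x - y)"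
proof -
  define S T where "S = prox own X f \<mu> i x" and "T = prox own X f \<mu> i y"
  have S: "S \<in> X i" and T: "T \<in> X i"
    unfolding S_def T_def by (auto intro: prox_minimises x y)
  have 1: "0 \<le> (g i (upd own i S x) + \<mu> i *\<^sub>R (S - proj own i x)) \<bullet> (T - S)"
    using prox_variational[OF x T, where \<mu>=\<mu>] by (simp add: S_def)
  have 2: "0 \<le> (g i (upd own i T y) + \<mu> i *\<^sub>R (T - proj own i y)) \<bullet> (S - T)"
    using prox_variational[OF y S, where \<mu>=\<mu>] by (simp add: T_def)
  have 3: "0 \<le> (g i (upd own i S x) - g i (upd own i T x)) \<bullet> (S - T)"
    by (rule pgrad_monotone[OF x T S])
  have "\<mu> i * (norm (S - T))\<^sup>2 \<le> 
      (g i (upd own i T y) - g i (upd own i T x)) \<bullet> (S - T) + \<mu> i * (proj own i (x - y) \<bullet> (S - T))"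
    using 1 2 3 unfolding power2_norm_eq_inner
    by (simp add: proj_diff inner_add_left inner_diff_left inner_diff_right algebra_simps inner_commute)
  also have "\<dots> \<le> L i * norm (x - y) * norm (S - T) + \<mu> i * (norm (x - y) * norm (S - T))"
  proof (intro add_mono mult_left_mono)
    have "norm (upd own i T y - upd own i T x) \<le> norm (x - y)"
    proof (rule power2_le_imp_le)
      show "(norm (upd own i T y - upd own i T x))\<^sup>2 \<le> (norm (x - y))\<^sup>2"
        unfolding norm_square_vec by (rule sum_mono) (auto simp: power2_commute)
    qed simp
    then have "norm (g i (upd own i T y) - g i (upd own i T x)) \<le> L i * norm (x - y)"
      by (intro order_trans[OF pgrad_lipschitz] upd_profiles x y T) (use L_pos[of i] in auto)
    then show "(g i (upd own i T y) - g i (upd own i T x)) \<bullet> (S - T) \<le> L i * norm (x - y) * norm (S - T)"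
      by (intro order_trans[OF norm_cauchy_schwarz] mult_right_mono) auto
    show "proj own i (x - y) \<bullet> (S - T) \<le> norm (x - y) * norm (S - T)"
      by (intro order_trans[OF norm_cauchy_schwarz] mult_right_mono norm_proj_le) auto
  qed (use \<mu> in auto)
  finally have "\<mu> i * norm (S - T) * norm (S - T) \<le> ((\<mu> i + L i) * norm (x - y)) * norm (S - T)"
    by (simp add: power2_eq_square algebra_simps)
  then have "\<mu> i * norm (S - T) \<le> (\<mu> i + L i) * norm (x - y) \<or> norm (S - T) = 0"
    by (metis mult_right_le_imp_le norm_ge_zero order_less_le)
  then show ?thesis
  proof
    assume "norm (S - T) = 0"
    then show ?thesis using \<mu> L_pos[of i] by (simp add: S_def T_def)
  qed (use \<mu> in \<open>simp add: S_def T_def field_simps\<close>)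
qed

lemma profiles_compact: "compact \<G>"
proof -
  have "closed \<G>"
  proof -
    have "\<G> = (\<Inter>i. proj own i -` X i)" by (auto simp: profiles_def)
    moreover have "closed (proj own i -` X i)" for i
    proof (intro closed_vimage compact_imp_closed X_compact)
      show "continuous_on UNIV (proj own i)" by (rule continuous_on_proj)
    qed
    ultimately show ?thesis by auto
  qed
  moreover have "bounded \<G>"
  proof -
    have "\<forall>i. \<exists>B. \<forall>v\<in>X i. norm v \<le> B"
      using X_compact compact_imp_bounded by (metis bounded_iff)
    then obtain B where B: "\<And>i v. v \<in> X i \<Longrightarrow> norm v \<le> B i" by metis
    have "norm x \<le> (\<Sum>i\<in>UNIV. B i)" if "x \<in> \<G>" for x
      using profilesD[OF that] B
      by (subst sum_proj[of own x, symmetric]) (intro sum_norm_le, auto)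
    then show ?thesis by (auto simp: bounded_iff)
  qed
  ultimately show ?thesis by (simp add: compact_eq_bounded_closed)
qed

lemma pgrad_bounded: "\<exists>C>0. \<forall>i. \<forall>x\<in>\<G>. norm (g i x) \<le> C"
proof -
  have "\<exists>C. \<forall>x\<in>\<G>. norm (g i x) \<le> C" for i
  proof -
    have "continuous_on \<G> (g i)"
      by (rule lipschitz_on_continuous_on[of "L i"], rule lipschitz_onI)
         (use pgrad_lipschitz L_pos[of i] in \<open>auto simp: dist_norm\<close>)
    then have "bounded (g i ` \<G>)"
      by (intro compact_imp_bounded compact_continuous_image profiles_compact)
    then show ?thesis by (auto simp: bounded_iff)
  qed
  then obtain C where C: "\<And>i x. x \<in> \<G> \<Longrightarrow> norm (g i x) \<le> C i" by metis
  have "norm (g i x) \<le> (\<Sum>i\<in>UNIV. \<bar>C i\<bar>) + 1" if "x \<in> \<G>" for i x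
    using C[OF that, of i] member_le_sum[of i UNIV "\<lambda>i. \<bar>C i\<bar>"] by auto
  then show ?thesis by (intro exI[of _ "(\<Sum>i\<in>UNIV. \<bar>C i\<bar>) + 1"]) (auto simp: add_nonneg_pos sum_nonneg)
qed

lemma X_diameter: "\<exists>D>0. \<forall>i. \<forall>a\<in>X i. \<forall>b\<in>X i. norm (a - b) \<le> D"
proof -
  have "bounded (\<Union>i. X i)"
    by (intro compact_imp_bounded compact_UN X_compact) simp
  then obtain B where "B > 0" and B: "\<And>a. a \<in> (\<Union>i. X i) \<Longrightarrow> norm a \<le> B"
    by (auto simp: bounded_pos)
  have "norm (a - b) \<le> B + B" if "a \<in> X i" "b \<in> X i" for i a b
    using that by (intro norm_triangle_le_diff add_mono B) auto
  with \<open>B > 0\<close> show ?thesis by (intro exI[of _ "B + B"]) auto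
qed

end

section \<open>Weighted potentials\<close>

locale potential_game = convex_game own X f L
  for own :: "'c::finite \<Rightarrow> 'i::finite" and X f L +
  fixes w :: "'i \<Rightarrow> real" and P :: "real ^ 'c \<Rightarrow> real" and U :: "(real ^ 'c) set"
  assumes w_pos: "\<And>i. 0 < w i"
    and U_open: "open U" and profiles_U: "profiles own X \<subseteq> U"
    and P_differentiable: "\<And>x. x \<in> U \<Longrightarrow> P differentiable (at x)"
    and gradient_P_continuous: "continuous_on U (gradient P)"
    and potential: "\<And>i x y y'. x \<in> profiles own X \<Longrightarrow> y \<in> X i \<Longrightarrow> y' \<in> X i \<Longrightarrow>
      P (upd own i y x) - P (upd own i y' x) = w i * (f i (upd own i y x) - f i (upd own i y' x))"
begin

text \<open>
  With \<open>x_{-i}\<close> fixed, the potential and \<open>w_i f_i\<close> differ by a constant on \<open>X_i\<close>, but \<open>X_i\<close> may have empty interior, so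
  their gradients may differ. They agree in feasible directions, because the difference is constant along
  the segment from \<open>x_i\<close> to \<open>v\<close>.
\<close>

lemma gradient_potential_block:
  assumes x: "x \<in> \<G>" and v: "v \<in> X i"
  shows "gradient P x \<bullet> (v - proj own i x) = w i * (g i x \<bullet> (v - proj own i x))"
proof -
  let ?p = "proj own i x"
  note p = profilesD[OF x, of i]
  define u where "u t = upd own i (?p + t *\<^sub>R (v - ?p)) x" for t
  have u: "u t = x + t *\<^sub>R (v - ?p)" for t
    using subsetD[OF X_block v] by (auto simp: u_def vec_eq_iff block_def)
  define \<psi> where "\<psi> t = P (u t) - w i * f i (u t)" for t
  have "P differentiable (at (x + 0 *\<^sub>R (v - ?p)))"
    using P_differentiable[of x] subsetD[OF profiles_U x] by simp
  note Pder = has_derivative_gradient[OF this]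
  have "((\<lambda>t. x + t *\<^sub>R (v - ?p)) has_derivative (\<lambda>s. s *\<^sub>R (v - ?p))) (at 0)"
    by (auto intro!: derivative_eq_intros)
  from has_derivative_compose[OF this Pder]
  have "((\<lambda>t. P (u t)) has_real_derivative gradient P x \<bullet> (v - ?p)) (at 0)"
    unfolding u has_field_derivative_def by (simp only: inner_scaleR_right mult_commute_abs scaleR_zero_left add_0_right)
  moreover have "((\<lambda>t. f i (u t)) has_real_derivative g i x \<bullet> (v - ?p)) (at 0)"
    unfolding u_def using cost_line_derivative[OF x p v, of 0] by simp
  ultimately have D: "(\<psi> has_real_derivative gradient P x \<bullet> (v - ?p) - w i * (g i x \<bullet> (v - ?p))) (at 0)"
    unfolding \<psi>_def by (intro DERIV_diff DERIV_cmult)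
  have const: "\<psi> t = \<psi> 0" if "0 \<le> t" "t \<le> 1" for t
    using potential[OF x segment_in[OF p v that] p] by (simp add: \<psi>_def u_def algebra_simps)
  have "0 \<le> gradient P x \<bullet> (v - ?p) - w i * (g i x \<bullet> (v - ?p))"
    by (rule deriv_nonneg_at_left_end[OF D]) (rule eq_refl, rule const[symmetric])
  moreover have "0 \<le> - (gradient P x \<bullet> (v - ?p) - w i * (g i x \<bullet> (v - ?p)))"
    by (rule deriv_nonneg_at_left_end[OF DERIV_minus[OF D]]) (rule eq_refl, rule arg_cong[of _ _ uminus], rule const[symmetric])
  ultimately show ?thesis by simp
qed

lemma gradient_potential_split:
  assumes x: "x \<in> \<G>" and v: "v \<in> \<G>"
  shows "gradient P x \<bullet> (x - v) = (\<Sum>i\<in>UNIV. w i * (g i x \<bullet> (proj own i x - proj own i v)))"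
proof -
  have "gradient P x \<bullet> (x - v) = (\<Sum>i\<in>UNIV. gradient P x \<bullet> proj own i (x - v))"
    by (simp add: inner_sum_right[symmetric] sum_proj)
  also have "\<dots> = (\<Sum>i\<in>UNIV. w i * (g i x \<bullet> (proj own i x - proj own i v)))"
    using gradient_potential_block[OF x profilesD[OF v]]
    by (intro sum.cong) (simp_all add: proj_diff inner_diff_right algebra_simps)
  finally show ?thesis .
qed

lemma gap_upper: "v \<in> \<G> \<Longrightarrow> gradient P x \<bullet> (x - v) \<le> gap own X P x"
  unfolding gap_def
proof (rule cSUP_upper)
  have "compact ((\<lambda>y. gradient P x \<bullet> (x - y)) ` \<G>)"
    by (intro compact_continuous_image profiles_compact continuous_intros)
  then show "bdd_above ((\<lambda>y. gradient P x \<bullet> (x - y)) ` \<G>)"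
    by (intro bounded_imp_bdd_above compact_imp_bounded)
qed

lemma gap_least:
  assumes "x \<in> \<G>" "\<And>v. v \<in> \<G> \<Longrightarrow> gradient P x \<bullet> (x - v) \<le> c"
  shows "gap own X P x \<le> c"
  unfolding gap_def using assms by (intro cSUP_least) auto

lemma gap_nonneg: "x \<in> \<G> \<Longrightarrow> 0 \<le> gap own X P x"
  using gap_upper[of x x] by simp

text \<open>
  Varying only block \<open>i\<close> in the supremum shows that no feasible direction decreases \<open>f_i\<close> to first order,
  which suffices by convexity.
\<close>

lemma gap_zero_imp_nash:
  assumes x: "x \<in> \<G>" and "gap own X P x \<le> 0"
  shows "x \<in> nash own X f"
proof -
  have "f i x \<le> f i (upd own i y x)" if y: "y \<in> X i" for i y
  proof -
    have "gradient P x \<bullet> (x - upd own i y x) \<le> 0"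
      using gap_upper[OF upd_profiles[OF x y], of x] assms(2) by simp
    moreover have "x - upd own i y x = - (y - proj own i x)"
      using subsetD[OF X_block y] by (auto simp: vec_eq_iff block_def)
    ultimately have "0 \<le> w i * (g i x \<bullet> (y - proj own i x))"
      unfolding gradient_potential_block[OF x y, symmetric] by (simp only: inner_minus_right)
    then have "0 \<le> g i x \<bullet> (y - proj own i x)"
      using w_pos[of i] by (simp add: zero_le_mult_iff)
    with cost_above_tangent[OF x profilesD[OF x, of i] y] show ?thesis by simp
  qed
  with x show ?thesis by (auto simp: nash_def)
qed

text \<open>
  The gap is \<open>\<nabla>P(x) \<bullet> x\<close> plus the support function of \<open>-X\<close> at \<open>\<nabla>P(x)\<close>, and the support function of a bounded
  set is Lipschitz.
\<close>

lemma gap_continuous: "continuous_on \<G> (gap own X P)"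
proof (rule continuous_on_eq)
  have 1: "continuous_on \<G> (gradient P)"
    using gradient_P_continuous profiles_U continuous_on_subset by blast
  obtain B where B: "\<And>x. x \<in> \<G> \<Longrightarrow> norm x \<le> B"
    using compact_imp_bounded[OF profiles_compact] by (auto simp: bounded_iff)
  define S where "S p = (SUP y\<in>\<G>. p \<bullet> (- y))" for p
  have bdd: "bdd_above ((\<lambda>y. p \<bullet> (- y)) ` \<G>)" for p
    by (intro bounded_imp_bdd_above compact_imp_bounded compact_continuous_image profiles_compact continuous_intros)
  show "continuous_on \<G> (\<lambda>x. gradient P x \<bullet> x + S (gradient P x))"
  proof (cases "\<G> = {}")
    case False
    have le: "S p \<le> S q + B * norm (p - q)" for p q
      unfolding S_def
    proof (rule cSUP_least[OF False])
      fix y assume y: "y \<in> \<G>"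
      have "p \<bullet> (- y) = q \<bullet> (- y) + (p - q) \<bullet> (- y)" by (simp add: inner_diff_left)
      also have "(p - q) \<bullet> (- y) \<le> norm (p - q) * norm (- y)" by (rule norm_cauchy_schwarz)
      also have "\<dots> \<le> B * norm (p - q)"
        using mult_right_mono[OF B[OF y], of "norm (p - q)"] by (simp add: mult.commute)
      also have "q \<bullet> (- y) \<le> (SUP y\<in>\<G>. q \<bullet> (- y))" by (rule cSUP_upper[OF y bdd])
      finally show "p \<bullet> (- y) \<le> (SUP y\<in>\<G>. q \<bullet> (- y)) + B * norm (p - q)" by simp
    qed
    have "0 \<le> B" using False B norm_ge_zero order_trans by blast
    moreover have "\<bar>S p - S q\<bar> \<le> B * norm (p - q)" for p q
      using le[of p q] le[of q p] by (simp add: norm_minus_commute abs_le_iff)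
    ultimately have "continuous_on UNIV S"
      by (intro lipschitz_on_continuous_on[of B] lipschitz_onI) (auto simp: dist_real_def dist_norm)
    then have "continuous_on \<G> (\<lambda>x. S (gradient P x))"
      by (rule continuous_on_compose2[OF _ 1]) auto
    then show ?thesis by (intro continuous_intros 1)
  qed simp
  fix x assume x: "x \<in> \<G>"
  show "gradient P x \<bullet> x + S (gradient P x) = gap own X P x"
  proof (rule antisym)
    have "S (gradient P x) \<le> gap own X P x - gradient P x \<bullet> x"
      unfolding S_def using x gap_upper[of _ x]
      by (intro cSUP_least) (auto simp: inner_diff_right algebra_simps)
    then show "gradient P x \<bullet> x + S (gradient P x) \<le> gap own X P x" by simp
    have "gradient P x \<bullet> (x - v) \<le> gradient P x \<bullet> x + S (gradient P x)" if "v \<in> \<G>" for v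
      using cSUP_upper[OF that bdd, of "gradient P x"] by (simp add: S_def inner_diff_right)
    then show "gap own X P x \<le> gradient P x \<bullet> x + S (gradient P x)"
      by (rule gap_least[OF x])
  qed
qed

text \<open>
  The variational inequality for \<open>T_i(y^i)\<close> bounds \<open>\<nabla>_i f_i(T_i, y^i) \<bullet> (T_i - v_i)\<close> by the residual.
  Replacing \<open>(T_i, y^i)\<close> by \<open>x\<close> costs a Lipschitz constant times residual plus delay error. The
  hypothesis on the \<open>i\<close>-th block expresses that a player knows the own strategy without delay.
\<close>

lemma gap_le_residuals:
  fixes \<mu> :: "'i \<Rightarrow> real"
  assumes \<mu>: "\<And>i. 0 < \<mu> i"
  shows "\<exists>C. \<forall>x\<in>\<G>. \<forall>y. (\<forall>i. y i \<in> \<G> \<and> proj own i (y i) = proj own i x) \<longrightarrow>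
    gap own X P x \<le> (\<Sum>i\<in>UNIV. C i * (norm (prox own X f \<mu> i (y i) - proj own i x) + norm (x - y i)))"
proof -
  obtain G where G: "\<And>i x. x \<in> \<G> \<Longrightarrow> norm (g i x) \<le> G"
    using pgrad_bounded by auto
  obtain B where B: "\<And>i a b. a \<in> X i \<Longrightarrow> b \<in> X i \<Longrightarrow> norm (a - b) \<le> B"
    using X_diameter by blast
  define C where "C i = w i * (G + L i * B + \<mu> i * B)" for i
  have "gap own X P x \<le> (\<Sum>i\<in>UNIV. C i * (norm (prox own X f \<mu> i (y i) - proj own i x) + norm (x - y i)))"
    if x: "x \<in> \<G>" and y: "\<And>i. y i \<in> \<G>" and xy: "\<And>i. proj own i (y i) = proj own i x" for x y
  proof (rule gap_least[OF x])
    fix v assume v: "v \<in> \<G>"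
    show "gradient P x \<bullet> (x - v) \<le> (\<Sum>i\<in>UNIV. C i * (norm (prox own X f \<mu> i (y i) - proj own i x) + norm (x - y i)))"
      unfolding gradient_potential_split[OF x v]
    proof (rule sum_mono)
      fix i
      define T h where "T = prox own X f \<mu> i (y i)" and "h = T - proj own i x"
      let ?v = "proj own i v" and ?n = "norm h + norm (x - y i)"
      note T = prox_minimises(1)[OF y[of i], where \<mu>=\<mu> and i=i, folded T_def]
      note vi = profilesD[OF v, of i]
      note nB = B[OF T vi]
      have B0: "0 \<le> B" using order_trans[OF norm_ge_zero nB] .
      have G0: "0 \<le> G" using order_trans[OF norm_ge_zero G[OF x]] .
      have "norm (x - upd own i T (y i)) \<le> norm (x - y i) + norm (upd own i (proj own i x) (y i) - upd own i T (y i))"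
        using norm_triangle_ineq[of "x - y i" "y i - upd own i T (y i)"] xy[of i] upd_proj_self[of own i "y i"]
        by simp
      also have "\<dots> = norm (x - y i) + norm h"
        by (subst norm_upd_diff[OF profilesD[OF x] T]) (simp add: h_def norm_minus_commute)
      finally have near: "norm (x - upd own i T (y i)) \<le> ?n" by simp
      have "g i x \<bullet> (proj own i x - ?v) =
          g i x \<bullet> (- h) + (g i x - g i (upd own i T (y i))) \<bullet> (T - ?v) + g i (upd own i T (y i)) \<bullet> (T - ?v)"
        by (simp add: h_def inner_diff_left inner_diff_right)
      also have "g i x \<bullet> (- h) \<le> G * norm h"
        using norm_cauchy_schwarz[of "g i x" "- h"] mult_right_mono[OF G[OF x, of i], of "norm h"] by simp
      also have "(g i x - g i (upd own i T (y i))) \<bullet> (T - ?v) \<le> (L i * ?n) * B"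
      proof (intro order_trans[OF norm_cauchy_schwarz] mult_mono nB)
        show "norm (g i x - g i (upd own i T (y i))) \<le> L i * ?n"
          using pgrad_lipschitz[OF x upd_profiles[OF y T], of i] near L_pos[of i]
          by (meson mult_left_mono order_less_imp_le order_trans)
      qed (use L_pos[of i] in auto)
      also have "g i (upd own i T (y i)) \<bullet> (T - ?v) \<le> \<mu> i * (norm h * B)"
      proof -
        have "0 \<le> (g i (upd own i T (y i)) + \<mu> i *\<^sub>R h) \<bullet> (?v - T)"
          using prox_variational[OF y[of i] vi, where \<mu>=\<mu>] by (simp add: T_def h_def xy)
        then have "g i (upd own i T (y i)) \<bullet> (T - ?v) \<le> \<mu> i * (h \<bullet> (?v - T))"
          by (simp add: inner_add_left inner_diff_right algebra_simps)
        also have "h \<bullet> (?v - T) \<le> norm h * B"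
          using norm_cauchy_schwarz[of h "?v - T"] mult_left_mono[OF nB, of "norm h"]
          by (simp add: norm_minus_commute)
        finally show ?thesis using \<mu>[of i] by (simp add: mult_left_mono)
      qed
      also have "G * norm h + (L i * ?n) * B + \<mu> i * (norm h * B) \<le> (G + L i * B + \<mu> i * B) * ?n"
        using G0 B0 \<mu>[of i] by (simp add: algebra_simps)
      finally show "w i * (g i x \<bullet> (proj own i x - ?v)) \<le> C i * (norm (prox own X f \<mu> i (y i) - proj own i x) + norm (x - y i))"
        using w_pos[of i] unfolding C_def T_def[symmetric] h_def[symmetric] mult.assoc
        by (intro mult_left_mono) auto
    qed
  qed
  then show ?thesis by blast
qed

lemma potential_bounded: "\<exists>m. \<forall>x\<in>\<G>. m \<le> P x"
proof -
  have "continuous_on \<G> P"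
    using P_differentiable profiles_U
    by (intro continuous_at_imp_continuous_on) (auto intro: differentiable_imp_continuous_within)
  then have "bounded (P ` \<G>)"
    by (intro compact_imp_bounded compact_continuous_image profiles_compact)
  then have "bdd_below (P ` \<G>)" by (rule bounded_imp_bdd_below)
  then show ?thesis by (auto simp: bdd_below_def)
qed

end

section \<open>A single trajectory of the scheme\<close>

text \<open>
  What holds along a fixed outcome. Only the error of the picked player enters the iterates, so
  \<open>e k\<close> carries no player index.
\<close>

locale trajectory = potential_game own X f L w P U
  for own :: "'c::finite \<Rightarrow> 'i::finite" and X f L w P U +
  fixes \<mu> :: "'i \<Rightarrow> real" and \<tau> :: nat and x :: "nat \<Rightarrow> real ^ 'c" and y :: "'i \<Rightarrow> nat \<Rightarrow> real ^ 'c"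
    and idx :: "nat \<Rightarrow> 'i" and d :: "'i \<Rightarrow> 'i \<Rightarrow> nat \<Rightarrow> nat" and e :: "nat \<Rightarrow> real ^ 'c"
  assumes mu: "\<And>i. \<mu> i > L i / 2 + sqrt 2 * real \<tau> * L i / 2 *
                ((avg L / L i) * (avg w / w i) + (L i / avg L) * (w i / avg w))"
    and tau_pos: "0 < \<tau>"
    and start: "x 0 \<in> profiles own X"
    and y_eq: "\<And>i k. y i k = (\<chi> c. x (k - d i (own c) k) $ c)"
    and d_self: "\<And>i k. d i i k = 0" and d_le: "\<And>i j k. d i j k \<le> \<tau>"
    and update: "\<And>k. proj own (idx k) (x (Suc k)) = prox own X f \<mu> (idx k) (y (idx k) k) + e k"
    and feasible: "\<And>k. proj own (idx k) (x (Suc k)) \<in> X (idx k)"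
    and others: "\<And>i k. i \<noteq> idx k \<Longrightarrow> proj own i (x (Suc k)) = proj own i (x k)"
begin

abbreviation "T i k \<equiv> prox own X f \<mu> i (y i k)"
abbreviation "h i k \<equiv> T i k - proj own i (x k)"

lemma x_feasible: "x k \<in> \<G>"
proof (induction k)
  case (Suc k)
  have "proj own i (x (Suc k)) \<in> X i" for i
    using feasible[of k] others[of i k] profilesD[OF Suc, of i] by (cases "i = idx k") auto
  then show ?case by (auto simp: profiles_def)
qed (rule start)

lemma proj_y: "proj own j (y i k) = proj own j (x (k - d i j k))"
  by (auto simp: y_eq vec_eq_iff)

lemma y_feasible: "y i k \<in> \<G>"
  using x_feasible by (auto simp: profiles_def proj_y)

lemma T_feasible: "T i k \<in> X i"
  by (rule prox_minimises(1)[OF y_feasible])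

lemma proj_y_self: "proj own i (y i k) = proj own i (x k)"
  by (simp add: proj_y d_self)

lemma x_Suc: "x (Suc k) = upd own (idx k) (T (idx k) k + e k) (x k)"
proof -
  have "x (Suc k) $ c = upd own (idx k) (T (idx k) k + e k) (x k) $ c" for c
    using arg_cong[OF update[of k], of "\<lambda>v. v $ c"] 
      arg_cong[OF others[of "own c" k], of "\<lambda>v. v $ c"] by (cases "own c = idx k") auto
  then show ?thesis by (simp add: vec_eq_iff)
qed

lemma x_step: "x (Suc k) - x k = h (idx k) k + e k"
proof -
  have "x (Suc k) - x k = proj own (idx k) (x (Suc k)) - proj own (idx k) (x k)"
  proof -
    have "(x (Suc k) - x k) $ c = (proj own (idx k) (x (Suc k)) - proj own (idx k) (x k)) $ c" for c
      using arg_cong[OF others[of "own c" k], of "\<lambda>v. v $ c"] by (cases "own c = idx k") auto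
    then show ?thesis by (simp add: vec_eq_iff)
  qed
  then show ?thesis by (simp add: update)
qed

lemma mu_pos: "0 < \<mu> i"
proof -
  have pos: "0 < avg L" "0 < avg w"
    unfolding avg_def using L_pos w_pos by (auto intro!: divide_pos_pos sum_pos)
  have "0 \<le> L i / 2 + sqrt 2 * real \<tau> * L i / 2 *
                ((avg L / L i) * (avg w / w i) + (L i / avg L) * (w i / avg w))"
    using pos L_pos[of i] w_pos[of i] by (intro add_nonneg_nonneg mult_nonneg_nonneg) auto
  with mu[of i] show ?thesis by linarith
qed

text \<open>
  Bounding each block separately lets every block have its own delay; Cauchy-Schwarz over at most
  \<open>\<tau>\<close> steps gives the factor \<open>\<tau>\<close>, and the blocks add up to full squared steps by Pythagoras.
\<close>

lemma delay_error: "(norm (x k - y i k))\<^sup>2 \<le> real \<tau> * (\<Sum>l\<in>{k-\<tau>..<k}. (norm (x (Suc l) - x l))\<^sup>2)"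
proof -
  have "(norm (proj own j (x k - y i k)))\<^sup>2
      \<le> real \<tau> * (\<Sum>l\<in>{k-\<tau>..<k}. (norm (proj own j (x (Suc l) - x l)))\<^sup>2)" for j
  proof -
    let ?n = "k - d i j k"
    let ?s = "\<lambda>l. norm (proj own j (x (Suc l) - x l))"
    have "proj own j (x k - y i k) = proj own j (x k) - proj own j (x ?n)"
      by (simp add: proj_diff proj_y)
    also have "\<dots> = (\<Sum>l\<in>{?n..<k}. proj own j (x (Suc l)) - proj own j (x l))"
      by (rule sum_Suc_diff'[symmetric]) simp
    also have "norm \<dots> \<le> (\<Sum>l\<in>{?n..<k}. ?s l)"
      by (rule order_trans[OF norm_sum]) (simp add: proj_diff)
    finally have "(norm (proj own j (x k - y i k)))\<^sup>2 \<le> (\<Sum>l\<in>{?n..<k}. ?s l)\<^sup>2"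
      by (rule power_mono) simp
    also have "\<dots> \<le> real (card {?n..<k}) * (\<Sum>l\<in>{?n..<k}. (?s l)\<^sup>2)"
      using sum_squared_le_sum_of_squares[of ?s "{?n..<k}"] by (simp add: mult.commute)
    also have "\<dots> \<le> real \<tau> * (\<Sum>l\<in>{k-\<tau>..<k}. (?s l)\<^sup>2)"
      using d_le[of i j k] by (intro mult_mono sum_mono2 sum_nonneg) auto
    finally show ?thesis .
  qed
  then have "(norm (x k - y i k))\<^sup>2 \<le>
      (\<Sum>j\<in>UNIV. real \<tau> * (\<Sum>l\<in>{k-\<tau>..<k}. (norm (proj own j (x (Suc l) - x l)))\<^sup>2))"
    unfolding norm_square_proj[of "x k - y i k" own] by (rule sum_mono)
  also have "\<dots> = real \<tau> * (\<Sum>l\<in>{k-\<tau>..<k}. (norm (x (Suc l) - x l))\<^sup>2)"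
    unfolding sum_distrib_left[symmetric]
    by (subst sum.swap) (intro arg_cong[of _ _ "(*) (real \<tau>)"] sum.cong refl norm_square_proj[symmetric])
  finally show ?thesis .
qed

text \<open>
  The inexact point is compared with the exact proximal point by convexity (cost \<open>G |e|\<close>), and the
  exact point with \<open>x(k)\<close> by the descent lemma. The gradient that the player used was taken at
  \<open>y^i(k)\<close>, hence the cross term.
\<close>

lemma potential_step:
  fixes k :: nat
  assumes G: "\<And>i x. x \<in> \<G> \<Longrightarrow> norm (g i x) \<le> G"
  defines "i \<equiv> idx k"
  shows "P (x (Suc k)) \<le> P (x k) - w i * (\<mu> i - L i / 2) * (norm (h i k))\<^sup>2
     + w i * L i * norm (x k - y i k) * norm (h i k) + w i * G * norm (e k)"
proof -
  let ?b = "T i k + e k"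
  have b: "?b \<in> X i" using feasible[of k] update[of k] by (simp add: i_def)
  note x = x_feasible[of k] and y = y_feasible[of i k] and T = T_feasible[of i k]
  note p = profilesD[OF x, of i]
  have "f i (upd own i ?b (x k)) \<le> f i (upd own i (T i k) (x k)) + g i (upd own i ?b (x k)) \<bullet> e k"
    using cost_above_tangent[OF x b T] by simp
  also have "g i (upd own i ?b (x k)) \<bullet> e k \<le> G * norm (e k)"
    by (intro order_trans[OF norm_cauchy_schwarz] mult_right_mono G upd_profiles x b) auto
  also have "f i (upd own i (T i k) (x k)) \<le> f i (x k) + g i (x k) \<bullet> h i k + L i / 2 * (norm (h i k))\<^sup>2"
    using cost_descent[OF x p T] by simp
  also have "g i (x k) \<bullet> h i k = g i (y i k) \<bullet> h i k + (g i (x k) - g i (y i k)) \<bullet> h i k"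
    by (simp add: inner_diff_left)
  also have "g i (y i k) \<bullet> h i k \<le> - \<mu> i * (norm (h i k))\<^sup>2"
    using prox_decrease[OF y, where i=i and \<mu>=\<mu>] by (simp add: proj_y_self)
  also have "(g i (x k) - g i (y i k)) \<bullet> h i k \<le> L i * norm (x k - y i k) * norm (h i k)"
    by (intro order_trans[OF norm_cauchy_schwarz] mult_right_mono pgrad_lipschitz x y) auto
  finally have "f i (upd own i ?b (x k)) - f i (x k) \<le> - (\<mu> i - L i / 2) * (norm (h i k))\<^sup>2
     + L i * norm (x k - y i k) * norm (h i k) + G * norm (e k)"
    by (simp add: algebra_simps)
  from mult_left_mono[OF this, of "w i"] w_pos[of i] potential[OF x b p] show ?thesis
    by (simp add: x_Suc i_def[symmetric] algebra_simps)
qed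

text \<open>
  The lower bound on \<open>\<mu>_i\<close> multiplied by \<open>w_i\<close>: with \<open>A = L_ave w_ave\<close> the bracket becomes
  \<open>(A + (w_i L_i)\<^sup>2 / A) / (w_i L_i)\<close>, and \<open>sqrt 2 \<ge> 1\<close>.
\<close>

lemma step_size_margin:
  defines "A \<equiv> avg L * avg w"
  shows "0 < A" "real \<tau> * (w i * L i)\<^sup>2 / (2 * A) + A / 2 * real \<tau> < w i * (\<mu> i - L i / 2)"
proof -
  have pos: "0 < avg L" "0 < avg w"
    unfolding avg_def using L_pos w_pos by (auto intro!: divide_pos_pos sum_pos)
  then show "0 < A" by (simp add: A_def)
  let ?S = "A + (w i * L i)\<^sup>2 / A"
  have "w i * (sqrt 2 * real \<tau> * L i / 2 * ((avg L / L i) * (avg w / w i) + (L i / avg L) * (w i / avg w)))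
      = sqrt 2 * (real \<tau> / 2 * ?S)"
    using pos L_pos[of i] w_pos[of i] by (simp add: A_def field_simps power2_eq_square)
  moreover have "1 * (real \<tau> / 2 * ?S) \<le> sqrt 2 * (real \<tau> / 2 * ?S)"
    using \<open>0 < A\<close> by (intro mult_right_mono) auto
  moreover have "w i * (sqrt 2 * real \<tau> * L i / 2 * ((avg L / L i) * (avg w / w i) + (L i / avg L) * (w i / avg w)))
      < w i * (\<mu> i - L i / 2)"
    by (rule mult_strict_left_mono[OF _ w_pos]) (use mu[of i] in linarith)
  ultimately have "real \<tau> / 2 * ?S < w i * (\<mu> i - L i / 2)" by linarith
  then show "real \<tau> * (w i * L i)\<^sup>2 / (2 * A) + A / 2 * real \<tau> < w i * (\<mu> i - L i / 2)"
    using \<open>0 < A\<close> by (simp add: field_simps)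
qed

lemma error_bounded: "\<exists>D>0. \<forall>k i. norm (h i k) \<le> D \<and> norm (e k) \<le> D"
proof -
  obtain D where D: "D > 0" "\<And>i a b. a \<in> X i \<Longrightarrow> b \<in> X i \<Longrightarrow> norm (a - b) \<le> D"
    using X_diameter by blast
  have "norm (h i k) \<le> D" for i k
    by (rule D(2)[OF T_feasible profilesD[OF x_feasible]])
  moreover have "norm (e k) \<le> D" for k
    using D(2)[OF feasible[of k] T_feasible[of "idx k" k]] by (simp add: update)
  ultimately show ?thesis using D(1) by blast
qed

text \<open>
  The heart of the proof, valid on each path. Each squared step is counted by at most \<open>\<tau>\<close> later
  delay errors, so Young's inequality with the weight \<open>A\<close> leaves a uniform margin \<open>\<eta>\<close>. Squares of errors
  are absorbed in the errors themselves since everything is bounded.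
\<close>

lemma picked_residuals_summable:
  assumes e: "summable (\<lambda>k. norm (e k))"
  shows "summable (\<lambda>k. (norm (h (idx k) k))\<^sup>2)"
proof -
  define A where "A = avg L * avg w"
  note margin = step_size_margin[folded A_def]
  define \<eta> where "\<eta> = Min (range (\<lambda>i. w i * (\<mu> i - L i / 2) - real \<tau> * (w i * L i)\<^sup>2 / (2 * A) - A / 2 * real \<tau>))"
  have \<eta>_pos: "0 < \<eta>"
    using margin(2) by (auto simp: \<eta>_def Min_gr_iff algebra_simps)
  have \<eta>_le: "A / 2 * real \<tau> + \<eta> \<le> w i * (\<mu> i - L i / 2) - real \<tau> * (w i * L i)\<^sup>2 / (2 * A)" for i
  proof -
    have "\<eta> \<le> w i * (\<mu> i - L i / 2) - real \<tau> * (w i * L i)\<^sup>2 / (2 * A) - A / 2 * real \<tau>"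
      unfolding \<eta>_def by (rule Min_le) auto
    then show ?thesis by simp
  qed
  obtain G where G: "G > 0" "\<And>i x. x \<in> \<G> \<Longrightarrow> norm (g i x) \<le> G"
    using pgrad_bounded by auto
  obtain D where D: "D > 0" "\<And>i k. norm (h i k) \<le> D" "\<And>k. norm (e k) \<le> D"
    using error_bounded by auto
  obtain m where m: "\<And>x. x \<in> \<G> \<Longrightarrow> m \<le> P x" using potential_bounded by auto
  define W where "W = (\<Sum>i\<in>UNIV. w i)"
  have wW: "w i \<le> W" for i
    unfolding W_def using w_pos by (intro member_le_sum) (auto intro: less_imp_le)
  have W0: "0 \<le> W"
    unfolding W_def by (intro sum_nonneg less_imp_le w_pos)
  show ?thesis
  proof (rule summable_of_delayed_descent[of m "\<lambda>k. P (x k)" _ "\<lambda>l. (norm (x (Suc l) - x l))\<^sup>2"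
        \<eta> "A/2" \<tau> "W * G" "\<lambda>k. norm (e k)" "3 * D"])
    fix k
    define i where "i = idx k"
    let ?H = "(norm (h i k))\<^sup>2" and ?r = "norm (x k - y i k)"
      and ?S = "\<Sum>l\<in>{k-\<tau>..<k}. (norm (x (Suc l) - x l))\<^sup>2"
    \<comment> \<open>Young's inequality, weighted so that both delay contributions fit under the margin.\<close>
    have "0 \<le> (real \<tau> * (w i * L i) * norm (h i k) - A * ?r)\<^sup>2 / (2 * real \<tau> * A)"
      using margin(1) by simp
    also have "\<dots> = real \<tau> * (w i * L i)\<^sup>2 / (2 * A) * ?H + A / (2 * real \<tau>) * ?r\<^sup>2
         - w i * L i * ?r * norm (h i k)"
      using margin(1) tau_pos by (simp add: power2_eq_square field_simps)
    finally have young: "w i * L i * ?r * norm (h i k)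
        \<le> real \<tau> * (w i * L i)\<^sup>2 / (2 * A) * ?H + A / (2 * real \<tau>) * ?r\<^sup>2" by simp
    have "A / (2 * real \<tau>) * ?r\<^sup>2 \<le> A / (2 * real \<tau>) * (real \<tau> * ?S)"
      using margin(1) by (intro mult_left_mono delay_error) auto
    also have "\<dots> = A / 2 * ?S" using tau_pos by simp
    finally have delay: "A / (2 * real \<tau>) * ?r\<^sup>2 \<le> A / 2 * ?S" .
    have "(A / 2 * real \<tau> + \<eta>) * ?H \<le> (w i * (\<mu> i - L i / 2) - real \<tau> * (w i * L i)\<^sup>2 / (2 * A)) * ?H"
      by (intro mult_right_mono \<eta>_le) auto
    moreover have "w i * G * norm (e k) \<le> W * G * norm (e k)"
      using wW G(1) by (intro mult_right_mono) auto
    ultimately show "P (x (Suc k)) + (A / 2 * real \<tau> + \<eta>) * (norm (h (idx k) k))\<^sup>2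
       \<le> P (x k) + A / 2 * ?S + W * G * norm (e k)"
      using potential_step[OF G(2), of k] young delay
      unfolding i_def[symmetric] left_diff_distrib by linarith
  next
    fix k
    have "(norm (x (Suc k) - x k))\<^sup>2 \<le> (norm (h (idx k) k) + norm (e k))\<^sup>2"
      unfolding x_step by (intro power_mono norm_triangle_ineq) auto
    also have "\<dots> = (norm (h (idx k) k))\<^sup>2 + (2 * norm (h (idx k) k) + norm (e k)) * norm (e k)"
      by (simp add: power2_eq_square algebra_simps)
    also have "(2 * norm (h (idx k) k) + norm (e k)) * norm (e k) \<le> 3 * D * norm (e k)"
      using D(2)[of "idx k" k] D(3)[of k] by (intro mult_right_mono) auto
    finally show "(norm (x (Suc k) - x k))\<^sup>2 \<le> (norm (h (idx k) k))\<^sup>2 + 3 * D * norm (e k)" by simp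
  qed (use m x_feasible \<eta>_pos margin(1) e G(1) D(1) W0 in auto)
qed

lemma steps_vanish:
  assumes "summable (\<lambda>k. norm (e k))"
  shows "(\<lambda>k. x (Suc k) - x k) \<longlonglongrightarrow> 0"
proof -
  have "(\<lambda>k. sqrt ((norm (h (idx k) k))\<^sup>2)) \<longlonglongrightarrow> sqrt 0"
    by (intro tendsto_real_sqrt summable_LIMSEQ_zero picked_residuals_summable assms)
  then have "(\<lambda>k. h (idx k) k) \<longlonglongrightarrow> 0"
    by (simp add: tendsto_norm_zero_iff)
  moreover have "e \<longlonglongrightarrow> 0"
    using summable_LIMSEQ_zero[OF assms] by (simp add: tendsto_norm_zero_iff)
  ultimately show ?thesis
    unfolding x_step using tendsto_add[of _ 0 _ e 0] by simp
qed

lemma delays_vanish: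
  assumes "summable (\<lambda>k. norm (e k))"
  shows "(\<lambda>k. norm (x k - y i k)) \<longlonglongrightarrow> 0"
proof -
  let ?s = "\<lambda>l. (norm (x (Suc l) - x l))\<^sup>2"
  have s: "?s \<longlonglongrightarrow> 0"
    using tendsto_power[OF tendsto_norm_zero[OF steps_vanish[OF assms]], of 2] by simp
  have window: "(\<Sum>l\<in>{k-\<tau>..<k}. ?s l) \<le> (\<Sum>a\<in>{..\<tau>}. ?s (k - a))" for k
  proof -
    have "(\<Sum>l\<in>{k-\<tau>..<k}. ?s l) = (\<Sum>a\<in>(\<lambda>l. k - l) ` {k-\<tau>..<k}. ?s (k - a))"
      by (subst sum.reindex) (auto simp: inj_on_def intro!: sum.cong)
    also have "\<dots> \<le> (\<Sum>a\<in>{..\<tau>}. ?s (k - a))"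
      by (rule sum_mono2) auto
    finally show ?thesis .
  qed
  have "(\<lambda>k. sqrt (real \<tau> * (\<Sum>a\<in>{..\<tau>}. ?s (k - a)))) \<longlonglongrightarrow> sqrt (real \<tau> * (\<Sum>a\<in>{..\<tau>}. 0))"
  proof (intro tendsto_intros)
    show "(\<lambda>k. ?s (k - a)) \<longlonglongrightarrow> 0" for a
      by (rule filterlim_compose[OF s filterlim_minus_const_nat_at_top])
  qed
  then have lim: "(\<lambda>k. sqrt (real \<tau> * (\<Sum>a\<in>{..\<tau>}. ?s (k - a)))) \<longlonglongrightarrow> 0"
    by (simp only: sum.neutral_const mult_zero_right real_sqrt_zero)
  have "norm (x k - y i k) \<le> sqrt (real \<tau> * (\<Sum>a\<in>{..\<tau>}. ?s (k - a)))" for k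
    by (rule real_le_rsqrt, rule order_trans[OF delay_error]) (intro mult_left_mono window, simp)
  then show ?thesis
    by (intro tendsto_sandwich[OF _ _ tendsto_const lim] always_eventually allI norm_ge_zero)
qed

lemma gap_vanishes:
  assumes "summable (\<lambda>k. norm (e k))" and "\<And>i. summable (\<lambda>k. (norm (h i k))\<^sup>2)"
  shows "(\<lambda>k. gap own X P (x k)) \<longlonglongrightarrow> 0"
proof -
  obtain C where C0: "\<forall>x\<in>\<G>. \<forall>y. (\<forall>i. y i \<in> \<G> \<and> proj own i (y i) = proj own i x) \<longrightarrow>
      gap own X P x \<le> (\<Sum>i\<in>UNIV. C i * (norm (prox own X f \<mu> i (y i) - proj own i x) + norm (x - y i)))"
    using gap_le_residuals[of \<mu>, OF mu_pos] by (elim exE) (rule that)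
  have C: "gap own X P (x k) \<le> (\<Sum>i\<in>UNIV. C i * (norm (h i k) + norm (x k - y i k)))" for k
    by (rule mp[OF spec[OF bspec[OF C0 x_feasible], where x="\<lambda>i. y i k"]])
       (simp add: y_feasible proj_y_self)
  have h: "(\<lambda>k. norm (h i k)) \<longlonglongrightarrow> 0" for i
    using tendsto_real_sqrt[OF summable_LIMSEQ_zero[OF assms(2)[of i]]] by simp
  have "(\<lambda>k. \<Sum>i\<in>UNIV. C i * (norm (h i k) + norm (x k - y i k))) \<longlonglongrightarrow> (\<Sum>i\<in>UNIV. C i * (0 + 0))"
    by (intro tendsto_intros h delays_vanish assms)
  then have lim: "(\<lambda>k. \<Sum>i\<in>UNIV. C i * (norm (h i k) + norm (x k - y i k))) \<longlonglongrightarrow> 0"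
    by (simp only: sum.neutral_const mult_zero_right add_0_right)
  show ?thesis
    by (intro tendsto_sandwich[OF _ _ tendsto_const lim] always_eventually allI C gap_nonneg x_feasible)
qed

lemma limit_points_nash:
  assumes "(\<lambda>k. gap own X P (x k)) \<longlonglongrightarrow> 0" "strict_mono r" "(\<lambda>n. x (r n)) \<longlonglongrightarrow> z"
  shows "z \<in> nash own X f"
proof (rule gap_zero_imp_nash)
  show z: "z \<in> \<G>"
    using compact_imp_closed[OF profiles_compact] x_feasible assms(3)
    by (meson closed_sequentially)
  have "(\<lambda>n. gap own X P (x (r n))) \<longlonglongrightarrow> gap own X P z"
    using gap_continuous z x_feasible assms(3) by (auto intro: continuous_on_tendsto_compose)
  moreover have "(\<lambda>n. gap own X P (x (r n))) \<longlonglongrightarrow> 0"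
    using LIMSEQ_subseq_LIMSEQ[OF assms(1,2)] by (simp add: o_def)
  ultimately show "gap own X P z \<le> 0"
    using LIMSEQ_unique by fastforce
qed

end

section \<open>Integrals over sub-sigma-algebras\<close>

text \<open>
  Two densities that agree on the events of \<open>F\<close> induce the same measure on \<open>F\<close>.
\<close>

lemma nn_integral_determined_by_subalgebra:
  assumes F: "subalgebra M F"
    and [measurable]: "b \<in> borel_measurable M" "b' \<in> borel_measurable M"
    and f: "f \<in> borel_measurable F"
    and eq: "\<And>E. E \<in> sets F \<Longrightarrow> (\<integral>\<^sup>+\<omega>. b \<omega> * indicator E \<omega> \<partial>M) = (\<integral>\<^sup>+\<omega>. b' \<omega> * indicator E \<omega> \<partial>M)"
  shows "(\<integral>\<^sup>+\<omega>. b \<omega> * f \<omega> \<partial>M) = (\<integral>\<^sup>+\<omega>. b' \<omega> * f \<omega> \<partial>M)"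
proof -
  have sub: "subalgebra (density M h) F" for h
    using F by (simp add: subalgebra_def)
  have fM[measurable]: "f \<in> borel_measurable M"
    by (rule measurable_from_subalg[OF F f])
  have E: "E \<in> sets M" if "E \<in> sets F" for E
    using F that by (auto simp: subalgebra_def)
  have "restr_to_subalg (density M b) F = restr_to_subalg (density M b') F"
  proof (rule measure_eqI)
    fix E assume "E \<in> sets (restr_to_subalg (density M b) F)"
    then have "E \<in> sets F" by (simp add: sets_restr_to_subalg[OF sub])
    then show "emeasure (restr_to_subalg (density M b) F) E = emeasure (restr_to_subalg (density M b') F) E"
      using E eq by (simp add: emeasure_restr_to_subalg[OF sub] emeasure_density)
  qed (simp add: sets_restr_to_subalg[OF sub])
  then have "(\<integral>\<^sup>+\<omega>. f \<omega> \<partial>density M b) = (\<integral>\<^sup>+\<omega>. f \<omega> \<partial>density M b')"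
    using nn_integral_subalgebra2[OF sub f] by metis
  then show ?thesis
    by (simp add: nn_integral_density)
qed

text \<open>
  Uniqueness of measures on a \<open>\<inter>\<close>-stable generator, applied to densities.
\<close>

lemma nn_integral_determined_by_generator:
  assumes gen: "sets F = sigma_sets (space M) G" "Int_stable G" "G \<subseteq> sets M"
    and [measurable]: "b \<in> borel_measurable M" "b' \<in> borel_measurable M"
    and eq: "\<And>E. E \<in> G \<Longrightarrow> (\<integral>\<^sup>+\<omega>. b \<omega> * indicator E \<omega> \<partial>M) = (\<integral>\<^sup>+\<omega>. b' \<omega> * indicator E \<omega> \<partial>M)"
    and cover: "range A \<subseteq> G" "(\<Union>n::nat. A n) = space M"
    and fin: "(\<integral>\<^sup>+\<omega>. b \<omega> \<partial>M) \<noteq> \<infinity>"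
    and E: "E \<in> sets F"
  shows "(\<integral>\<^sup>+\<omega>. b \<omega> * indicator E \<omega> \<partial>M) = (\<integral>\<^sup>+\<omega>. b' \<omega> * indicator E \<omega> \<partial>M)"
proof -
  have pow: "G \<subseteq> Pow (space M)" using gen(3) sets.sets_into_space by blast
  have subM: "sigma_sets (space M) G \<subseteq> sets M" by (rule sets.sigma_sets_subset[OF gen(3)])
  let ?F = "sigma (space M) G"
  have sub: "subalgebra (density M h) ?F" for h
    using subM pow by (simp add: subalgebra_def space_measure_of sets_measure_of)
  have em: "emeasure (restr_to_subalg (density M h) ?F) E = (\<integral>\<^sup>+\<omega>. h \<omega> * indicator E \<omega> \<partial>M)"
    if "E \<in> sigma_sets (space M) G" "h \<in> borel_measurable M" for E h
  proof -
    have "E \<in> sets M" using that(1) subM by blast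
    then show ?thesis
      using that pow by (simp add: emeasure_restr_to_subalg[OF sub] sets_measure_of emeasure_density)
  qed
  have "restr_to_subalg (density M b) ?F = restr_to_subalg (density M b') ?F"
  proof (rule measure_eqI_generator_eq[OF gen(2) pow _ _ _ cover])
    show "emeasure (restr_to_subalg (density M b) ?F) E = emeasure (restr_to_subalg (density M b') ?F) E"
      if "E \<in> G" for E
      using that eq by (simp add: em sigma_sets.Basic)
    show "emeasure (restr_to_subalg (density M b) ?F) (A n) \<noteq> \<infinity>" for n
    proof -
      have "A n \<in> G" using cover(1) by auto
      then have "emeasure (restr_to_subalg (density M b) ?F) (A n) = (\<integral>\<^sup>+\<omega>. b \<omega> * indicator (A n) \<omega> \<partial>M)"
        by (simp add: em sigma_sets.Basic)
      also have "\<dots> \<le> (\<integral>\<^sup>+\<omega>. b \<omega> \<partial>M)"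
        by (intro nn_integral_mono) (auto split: split_indicator)
      finally show ?thesis using fin by (auto simp: top_unique)
    qed
  qed (use pow in \<open>simp_all add: sets_restr_to_subalg[OF sub] sets_measure_of\<close>)
  then show ?thesis
    using E em[of E b] em[of E b'] by (simp add: gen(1))
qed

lemma subalgebra_sigma:
  assumes "G \<subseteq> sets M"
  shows "subalgebra M (sigma (space M) G)" "G \<subseteq> sets (sigma (space M) G)"
proof -
  have pow: "G \<subseteq> Pow (space M)" using assms sets.sets_into_space by blast
  show "subalgebra M (sigma (space M) G)"
    using sets.sigma_sets_subset[OF assms]
    by (simp add: subalgebra_def sets_measure_of[OF pow] space_measure_of_conv)
  show "G \<subseteq> sets (sigma (space M) G)"
    by (auto simp: sets_measure_of[OF pow])
qed

lemma sets_sigma_subset: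
  assumes "subalgebra M F" "G \<subseteq> sets F"
  shows "sets (sigma (space M) G) \<subseteq> sets F"
proof -
  have pow: "G \<subseteq> Pow (space M)"
    using assms sets.sets_into_space[of _ F] by (auto simp: subalgebra_def)
  show ?thesis
    using sets.sigma_sets_subset[OF assms(2)] assms(1)
    by (simp add: subalgebra_def sets_measure_of[OF pow])
qed

lemma measurable_from_events:
  assumes "subalgebra M F" "events (space M) N Z \<subseteq> sets F" "Z \<in> M \<rightarrow>\<^sub>M N"
  shows "Z \<in> F \<rightarrow>\<^sub>M N"
proof (rule measurableI)
  show "Z \<omega> \<in> space N" if "\<omega> \<in> space F" for \<omega>
    using measurable_space[OF assms(3)] that assms(1) by (simp add: subalgebra_def)
  show "Z -` A \<inter> space F \<in> sets F" if "A \<in> sets N" for A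
    using assms(1,2) that by (auto simp: subalgebra_def events_def)
qed

lemma borel_measurable_compose_on:
  assumes g: "g \<in> borel_measurable N" and A: "\<And>\<omega>. \<omega> \<in> space N \<Longrightarrow> g \<omega> \<in> A" and F: "continuous_on A F"
  shows "(\<lambda>\<omega>. F (g \<omega>)) \<in> borel_measurable N"
  by (rule measurable_compose[OF measurable_restrict_space2[OF _ g] borel_measurable_continuous_on_restrict[OF F]])
     (use A in auto)

context prob_space
begin

lemma sigma_finite_subalgebra_prob: "subalgebra M F \<Longrightarrow> sigma_finite_subalgebra M F"
  by (intro finite_measure_subalgebra_is_sigma_finite finite_measure_subalgebra.intro
      finite_measure_subalgebra_axioms.intro) unfold_locales

text \<open>
  Independence, and the product rule for fresh samples, are given for events of \<open>F\<close>; this is the form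
  for \<open>F\<close>-measurable functions. Independence is the case \<open>B' = space M\<close>.
\<close>

lemma nn_integral_event_factor:
  assumes F: "subalgebra M F" and f: "f \<in> borel_measurable F" and B: "B \<in> sets M" "B' \<in> sets M" and "0 \<le> q"
    and eq: "\<And>E. E \<in> sets F \<Longrightarrow> prob (E \<inter> B) = q * prob (E \<inter> B')"
  shows "(\<integral>\<^sup>+\<omega>. indicator B \<omega> * f \<omega> \<partial>M) = ennreal q * (\<integral>\<^sup>+\<omega>. indicator B' \<omega> * f \<omega> \<partial>M)"
proof -
  have fM[measurable]: "f \<in> borel_measurable M"
    by (rule measurable_from_subalg[OF F f])
  note [measurable] = B
  have "(\<integral>\<^sup>+\<omega>. indicator B \<omega> * f \<omega> \<partial>M) = (\<integral>\<^sup>+\<omega>. (ennreal q * indicator B' \<omega>) * f \<omega> \<partial>M)"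
  proof (rule nn_integral_determined_by_subalgebra[OF F _ _ f])
    fix E assume E: "E \<in> sets F"
    then have [measurable]: "E \<in> sets M" using F by (auto simp: subalgebra_def)
    have "(\<integral>\<^sup>+\<omega>. indicator B \<omega> * indicator E \<omega> \<partial>M) = emeasure M (E \<inter> B)"
      by (simp add: indicator_inter_arith[symmetric] Int_commute)
    also have "\<dots> = ennreal q * emeasure M (E \<inter> B')"
      using eq[OF E] \<open>0 \<le> q\<close> by (simp add: emeasure_eq_measure ennreal_mult)
    also have "emeasure M (E \<inter> B') = (\<integral>\<^sup>+\<omega>. indicator B' \<omega> * indicator E \<omega> \<partial>M)"
      by (simp add: indicator_inter_arith[symmetric] Int_commute)
    finally show "(\<integral>\<^sup>+\<omega>. indicator B \<omega> * indicator E \<omega> \<partial>M)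
        = (\<integral>\<^sup>+\<omega>. (ennreal q * indicator B' \<omega>) * indicator E \<omega> \<partial>M)"
      by (simp add: nn_integral_cmult mult.assoc)
  qed auto
  then show ?thesis by (simp add: nn_integral_cmult mult.assoc)
qed

text \<open>
  Jensen's inequality for the concave function \<open>min _ 1\<close>, integrated over an event: split the event
  according to whether the conditional expectation exceeds \<open>1\<close>.
\<close>

lemma nn_integral_min_cond_exp_le:
  assumes N: "subalgebra M N" and [measurable]: "g \<in> borel_measurable M" and A: "A \<in> sets N"
  shows "(\<integral>\<^sup>+\<omega>. min (g \<omega>) 1 * indicator A \<omega> \<partial>M) \<le> (\<integral>\<^sup>+\<omega>. min (nn_cond_exp M N g \<omega>) 1 * indicator A \<omega> \<partial>M)"
proof -
  interpret N: sigma_finite_subalgebra M N by (rule sigma_finite_subalgebra_prob[OF N])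
  let ?b = "nn_cond_exp M N g"
  have bM[measurable]: "?b \<in> borel_measurable M"
    by (rule borel_measurable_nn_cond_exp2)
  have sp: "space N = space M" using N by (simp add: subalgebra_def)
  define B where "B = {\<omega> \<in> space N. ?b \<omega> \<le> 1} \<inter> A"
  have B: "B \<in> sets N" unfolding B_def using A by measurable
  have AM[measurable]: "A \<in> sets M" and BM[measurable]: "B \<in> sets M"
    using N A B by (auto simp: subalgebra_def)
  have "(\<integral>\<^sup>+\<omega>. min (g \<omega>) 1 * indicator A \<omega> \<partial>M) \<le> (\<integral>\<^sup>+\<omega>. indicator B \<omega> * g \<omega> + indicator (A - B) \<omega> \<partial>M)"
    by (intro nn_integral_mono) (auto split: split_indicator simp: B_def)
  also have "\<dots> = (\<integral>\<^sup>+\<omega>. indicator B \<omega> * g \<omega> \<partial>M) + (\<integral>\<^sup>+\<omega>. indicator (A - B) \<omega> \<partial>M)"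
    by (rule nn_integral_add) auto
  also have "(\<integral>\<^sup>+\<omega>. indicator B \<omega> * g \<omega> \<partial>M) = (\<integral>\<^sup>+\<omega>. indicator B \<omega> * ?b \<omega> \<partial>M)"
    by (rule N.nn_cond_exp_intg[symmetric]) (use B in auto)
  also have "\<dots> + (\<integral>\<^sup>+\<omega>. indicator (A - B) \<omega> \<partial>M) = (\<integral>\<^sup>+\<omega>. indicator B \<omega> * ?b \<omega> + indicator (A - B) \<omega> \<partial>M)"
    by (rule nn_integral_add[symmetric]) auto
  also have "\<dots> = (\<integral>\<^sup>+\<omega>. min (?b \<omega>) 1 * indicator A \<omega> \<partial>M)"
    by (intro nn_integral_cong) (auto split: split_indicator simp: B_def sp min_def)
  finally show ?thesis .
qed

text \<open>
  Stop at the first time at which the partial sums of \<open>v\<close> exceed \<open>c\<close>. The stopped sum of \<open>v\<close> is at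
  most \<open>c + 1\<close>, and the events of not having stopped are in \<open>F k\<close>, so the stopped sum of \<open>u\<close> has a finite
  expectation. Almost every path is never stopped for some \<open>c\<close>. Only \<open>v\<close> is adapted:
  errors and residuals, which take the place of \<open>u\<close>, depend on delays that the filtration forgets.
\<close>

lemma summable_transfer:
  fixes F :: "nat \<Rightarrow> 'a measure" and u v :: "nat \<Rightarrow> 'a \<Rightarrow> ennreal"
  assumes F: "\<And>k. subalgebra M (F k)" and mono: "\<And>k l. k \<le> l \<Longrightarrow> sets (F k) \<subseteq> sets (F l)"
    and u[measurable]: "\<And>k. u k \<in> borel_measurable M"
    and v: "\<And>k. v k \<in> borel_measurable (F (Suc k))" and v1: "\<And>k \<omega>. v k \<omega> \<le> 1"
    and le: "\<And>k A. A \<in> sets (F k) \<Longrightarrow>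
      (\<integral>\<^sup>+\<omega>. u k \<omega> * indicator A \<omega> \<partial>M) \<le> C * (\<integral>\<^sup>+\<omega>. v k \<omega> * indicator A \<omega> \<partial>M)"
    and C: "C < \<infinity>" and fin: "AE \<omega> in M. (\<Sum>k. v k \<omega>) < \<infinity>"
  shows "AE \<omega> in M. (\<Sum>k. u k \<omega>) < \<infinity>"
proof -
  have vM[measurable]: "v k \<in> borel_measurable M" for k
    by (rule measurable_from_subalg[OF F v])
  define A where "A c k = {\<omega> \<in> space M. (\<Sum>l<k. v l \<omega>) \<le> of_nat c}" for c k :: nat
  have A: "A c k \<in> sets (F k)" for c k
  proof -
    have "v l \<in> borel_measurable (F k)" if "l < k" for l
    proof (rule measurable_mono[THEN subsetD, OF order_refl refl _ _ v])
      show "sets (F (Suc l)) \<subseteq> sets (F k)" using that by (intro mono) auto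
      show "space (F (Suc l)) = space (F k)" using F by (simp add: subalgebra_def)
    qed
    then have "(\<lambda>\<omega>. \<Sum>l<k. v l \<omega>) \<in> borel_measurable (F k)"
      by (intro borel_measurable_sum) auto
    then have "{\<omega> \<in> space (F k). (\<Sum>l<k. v l \<omega>) \<le> of_nat c} \<in> sets (F k)"
      by measurable
    then show ?thesis using F[of k] by (simp add: A_def subalgebra_def)
  qed
  have AM[measurable]: "A c k \<in> sets M" for c k
    using A[of c k] F[of k] by (auto simp: subalgebra_def)
  have stopped: "(\<Sum>k<n. v k \<omega> * indicator (A c k) \<omega>) \<le> of_nat c + 1" if "\<omega> \<in> space M" for c n \<omega>
  proof (induction n)
    case (Suc n)
    show ?case
    proof (cases "\<omega> \<in> A c n")
      case True
      have "(\<Sum>k<n. v k \<omega> * indicator (A c k) \<omega>) \<le> (\<Sum>k<n. v k \<omega>)"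
        by (intro sum_mono) (auto split: split_indicator)
      also have "\<dots> \<le> of_nat c" using True by (simp add: A_def)
      finally show ?thesis using True v1[of n \<omega>] by (simp add: add_mono)
    qed (use Suc in simp)
  qed simp
  have "AE \<omega> in M. (\<Sum>k. u k \<omega> * indicator (A c k) \<omega>) \<noteq> \<infinity>" for c
  proof (rule nn_integral_PInf_AE)
    have "(\<integral>\<^sup>+\<omega>. (\<Sum>k. u k \<omega> * indicator (A c k) \<omega>) \<partial>M) = (\<Sum>k. \<integral>\<^sup>+\<omega>. u k \<omega> * indicator (A c k) \<omega> \<partial>M)"
      by (rule nn_integral_suminf) auto
    also have "\<dots> \<le> (\<Sum>k. C * (\<integral>\<^sup>+\<omega>. v k \<omega> * indicator (A c k) \<omega> \<partial>M))"
      by (intro suminf_le le A) auto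
    also have "\<dots> = C * (\<Sum>k. \<integral>\<^sup>+\<omega>. v k \<omega> * indicator (A c k) \<omega> \<partial>M)"
      by (rule ennreal_suminf_cmult)
    also have "(\<Sum>k. \<integral>\<^sup>+\<omega>. v k \<omega> * indicator (A c k) \<omega> \<partial>M) = (\<integral>\<^sup>+\<omega>. (\<Sum>k. v k \<omega> * indicator (A c k) \<omega>) \<partial>M)"
      by (rule nn_integral_suminf[symmetric]) auto
    also have "\<dots> \<le> (\<integral>\<^sup>+\<omega>. of_nat c + 1 \<partial>M)"
      by (intro nn_integral_mono suminf_le_const stopped) auto
    also have "\<dots> = of_nat c + 1"
      by (simp add: emeasure_space_1)
    finally have "(\<integral>\<^sup>+\<omega>. (\<Sum>k. u k \<omega> * indicator (A c k) \<omega>) \<partial>M) \<le> C * (of_nat c + 1)"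
      by (simp add: mult_left_mono)
    also have "\<dots> < \<infinity>" using C by (simp add: ennreal_mult_less_top of_nat_less_top)
    finally show "(\<integral>\<^sup>+\<omega>. (\<Sum>k. u k \<omega> * indicator (A c k) \<omega>) \<partial>M) \<noteq> \<infinity>" by simp
  qed auto
  then have "AE \<omega> in M. \<forall>c. (\<Sum>k. u k \<omega> * indicator (A c k) \<omega>) \<noteq> \<infinity>"
    by (simp add: AE_all_countable)
  with fin AE_space show ?thesis
  proof eventually_elim
    case (elim \<omega>)
    then obtain c :: nat where c: "(\<Sum>k. v k \<omega>) \<le> of_nat c"
      using ennreal_Ex_less_of_nat[of "\<Sum>k. v k \<omega>"] by (auto intro: less_imp_le)
    have "\<omega> \<in> A c k" for k
      using sum_le_suminf[of "\<lambda>k. v k \<omega>" "{..<k}"] c elim(2) by (auto simp: A_def intro: order_trans)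
    then have "(\<Sum>k. u k \<omega> * indicator (A c k) \<omega>) = (\<Sum>k. u k \<omega>)" by simp
    with elim(3) show ?case by (metis infinity_ennreal_def less_top)
  qed
qed

end

text \<open>
  Two sigma-fields may be comparable on the trace of an event \<open>I\<close> only; it suffices to check this on
  generators.
\<close>

lemma sigma_sets_trace:
  assumes E: "E \<in> sigma_sets \<Omega> G" and gen: "\<And>A. A \<in> G \<Longrightarrow> A \<inter> I \<in> sets N" and I: "I \<in> sets N" "I \<subseteq> \<Omega>"
  shows "E \<inter> I \<in> sets N"
  using E
proof (induction E rule: sigma_sets.induct)
  case (Compl a)
  have "(\<Omega> - a) \<inter> I = I - (a \<inter> I)" using I(2) by blast
  then show ?case using Compl I(1) by simp
next
  case (Union a)
  have "(\<Union>i. a i) \<inter> I = (\<Union>i. a i \<inter> I)" by blast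
  moreover have "(\<Union>i. a i \<inter> I) \<in> sets N" using Union by (intro sets.countable_UN) auto
  ultimately show ?case by simp
qed (use gen in auto)

lemma measurable_if_trace:
  assumes h: "h \<in> borel_measurable H" and tr: "\<And>E. E \<in> sets H \<Longrightarrow> E \<inter> I \<in> sets N"
    and sp: "space H = space N" and I: "I \<in> sets N"
  shows "(\<lambda>\<omega>. if \<omega> \<in> I then h \<omega> else 0) \<in> borel_measurable N"
proof (rule measurableI)
  fix B :: "'b set" assume B: "B \<in> sets borel"
  have "(\<lambda>\<omega>. if \<omega> \<in> I then h \<omega> else 0) -` B \<inter> space N
      = ((h -` B \<inter> space H) \<inter> I) \<union> (if 0 \<in> B then space N - I else {})"
    using sets.sets_into_space[OF I] by (auto simp: sp split: if_splits)
  moreover have "(h -` B \<inter> space H) \<inter> I \<in> sets N"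
    by (intro tr measurable_sets[OF h B])
  ultimately show "(\<lambda>\<omega>. if \<omega> \<in> I then h \<omega> else 0) -` B \<inter> space N \<in> sets N"
    using I by auto
qed simp

section \<open>Fresh samples\<close>

lemma events_subset_sets: "Z \<in> M \<rightarrow>\<^sub>M N \<Longrightarrow> events (space M) N Z \<subseteq> sets M"
  by (auto simp: events_def)

lemma space_list_borel [simp]: "space list_borel = UNIV"
  by (simp add: list_borel_def space_measure_of_conv)

lemma sets_list_borel: "sets list_borel =
    sigma_sets UNIV {{v. t < length v \<and> v ! t \<in> A} | t A. A \<in> sets borel}"
  unfolding list_borel_def by (rule sets_measure_of) auto

lemma cylinder_in_list_borel:
  fixes A :: "nat \<Rightarrow> 'a::topological_space set"
  assumes A: "\<And>t. t < n \<Longrightarrow> A t \<in> sets borel"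
  shows "{v. length v = n \<and> (\<forall>t<n. v ! t \<in> A t)} \<in> sets list_borel"
proof -
  have gen: "{v. t < length v \<and> v ! t \<in> B} \<in> sets list_borel" if "B \<in> sets borel" for t and B :: "'a set"
    unfolding sets_list_borel by (rule sigma_sets.Basic) (use that in blast)
  have "{v. length v = n \<and> (\<forall>t<n. v ! t \<in> A t)}
     = {v \<in> space list_borel. \<forall>t\<in>{..<n}. v \<in> {v. t < length v \<and> v ! t \<in> A t}} - {v. n < length v \<and> v ! n \<in> UNIV}"
    by (auto simp: not_less_iff_gr_or_eq)
  also have "\<dots> \<in> sets list_borel"
    by (intro sets.Diff gen sets.sets_Collect_finite_All) (auto intro: gen A)
  finally show ?thesis .
qed

text \<open>
  Let \<open>H\<close> be generated by \<open>N\<close> and the samples. On the \<open>\<inter>\<close>-stable generator of \<open>H\<close> consisting of events of \<open>N\<close>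
  intersected with sample cylinders of a given length, the product rule shows that the
  conditional probability given \<open>H\<close> of any event of \<open>F\<close> is the one given \<open>N\<close>, that is, \<open>F\<close> and
  \<open>H\<close> are conditionally independent given \<open>N\<close>. The claim is the symmetric form of this statement. That
  the length is \<open>N\<close>-measurable is essential, as it may otherwise carry information about \<open>F\<close>.
\<close>

lemma (in prob_space) cond_exp_fresh_samples:
  fixes \<xi> :: "'q \<Rightarrow> 'd::topological_space"
  assumes F: "subalgebra M F" and N: "subalgebra F N"
    and fresh: "fresh_samples M F Q \<xi> s"
    and len: "(\<lambda>\<omega>. length (s \<omega>)) \<in> N \<rightarrow>\<^sub>M count_space UNIV"
    and g: "g \<in> borel_measurable (sigma (space M) (sets N \<union> Defs.events (space M) list_borel s))"
  shows "AE \<omega> in M. nn_cond_exp M F g \<omega> = nn_cond_exp M N g \<omega>"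
proof -
  define H where "H = sigma (space M) (sets N \<union> Defs.events (space M) list_borel s)"
  define cyl where "cyl n A = {\<omega> \<in> space M. length (s \<omega>) = n \<and> (\<forall>t<n. s \<omega> ! t \<in> A t)}" for n A
  define G where "G = {E \<inter> cyl n A | E n A. E \<in> sets N \<and> (\<forall>t<n. A t \<in> sets borel)}"
  have sp: "space F = space M" "space N = space M"
    using F N by (auto simp: subalgebra_def)
  have NM: "subalgebra M N" using F N by (auto simp: subalgebra_def)
  interpret F: sigma_finite_subalgebra M F by (rule sigma_finite_subalgebra_prob[OF F])
  interpret N: sigma_finite_subalgebra M N by (rule sigma_finite_subalgebra_prob[OF NM])
  have s: "s \<in> M \<rightarrow>\<^sub>M list_borel" using fresh by (simp add: fresh_samples_def)
  have cylM: "cyl n A \<in> sets M" if "\<forall>t<n. A t \<in> sets borel" for n A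
  proof -
    have "cyl n A = s -` {v. length v = n \<and> (\<forall>t<n. v ! t \<in> A t)} \<inter> space M"
      by (auto simp: cyl_def)
    then show ?thesis
      using measurable_sets[OF s cylinder_in_list_borel, of n A] that by simp
  qed
  have NF: "sets N \<subseteq> sets F" and FM: "sets F \<subseteq> sets M"
    using N F by (auto simp: subalgebra_def)
  have lenN: "{\<omega> \<in> space M. length (s \<omega>) = n} \<in> sets N" for n
    using measurable_sets[OF len, of "{n}"] by (simp add: vimage_def Int_def sp conj_commute)
  have GI: "E \<inter> cyl n A \<in> G" if "E \<in> sets N" "\<forall>t<n. A t \<in> sets borel" for E n A
    unfolding G_def using that by blast
  have GM: "G \<subseteq> sets M"
  proof
    fix B assume "B \<in> G"
    then obtain E n A where B: "B = E \<inter> cyl n A" "E \<in> sets N" "\<forall>t<n. A t \<in> sets borel"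
      unfolding G_def by blast
    show "B \<in> sets M"
      unfolding B(1) by (intro sets.Int cylM B(3) subsetD[OF FM subsetD[OF NF B(2)]])
  qed
  have NeH: "sets N \<union> Defs.events (space M) list_borel s \<subseteq> sets M"
    using NF FM events_subset_sets[OF s] by blast
  have HM: "subalgebra M H"
    unfolding H_def subalgebra_def using sets.sigma_sets_subset[OF NeH] NeH sets.sets_into_space
    by (subst sets_measure_of) (auto simp: space_measure_of_conv)
  have sets_H: "sets H = sigma_sets (space M) (sets N \<union> Defs.events (space M) list_borel s)"
    unfolding H_def using NeH sets.sets_into_space by (intro sets_measure_of) blast
  have "G \<subseteq> sets H"
  proof
    fix B assume "B \<in> G"
    then obtain E n A where B: "B = E \<inter> cyl n A" "E \<in> sets N" "\<forall>t<n. A t \<in> sets borel"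
      unfolding G_def by blast
    have "cyl n A \<in> Defs.events (space M) list_borel s"
      unfolding Defs.events_def cyl_def using cylinder_in_list_borel[of n A] B(3)
      by (auto intro!: exI[of _ "{v. length v = n \<and> (\<forall>t<n. v ! t \<in> A t)}"])
    then have "cyl n A \<in> sets H" "E \<in> sets H" using B by (auto simp: sets_H)
    then show "B \<in> sets H" by (simp add: B(1))
  qed
  then have G_sub: "sigma_sets (space M) G \<subseteq> sets H"
    using HM sets.sigma_sets_subset[of G H] by (simp add: subalgebra_def)
  let ?SG = "sigma (space M) G"
  have Gpow: "G \<subseteq> Pow (space M)" using GM sets.sets_into_space by blast
  have setsSG: "sets ?SG = sigma_sets (space M) G" by (rule sets_measure_of[OF Gpow])
  have N_in: "E \<in> sets ?SG" if "E \<in> sets N" for E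
  proof -
    have E_eq: "E = (\<Union>n. E \<inter> cyl n (\<lambda>_. UNIV))"
      using sets.sets_into_space[OF that] by (auto simp: cyl_def sp)
    have "E \<inter> cyl n (\<lambda>_. UNIV) \<in> sets ?SG" for n
      unfolding setsSG by (rule sigma_sets.Basic) (use that in \<open>auto intro: GI\<close>)
    then have "(\<Union>n. E \<inter> cyl n (\<lambda>_. UNIV)) \<in> sets ?SG" by (intro sets.countable_UN) auto
    then show ?thesis by (subst E_eq)
  qed
  have s_SG: "s \<in> ?SG \<rightarrow>\<^sub>M list_borel"
    unfolding list_borel_def
  proof (rule measurable_measure_of)
    fix B assume "B \<in> {{v. t < length v \<and> v ! t \<in> A} | t A. A \<in> sets (borel::'d measure)}"
    then obtain t A where B: "B = {v. t < length v \<and> v ! t \<in> A}" "A \<in> sets borel" by auto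
    have "s -` B \<inter> space ?SG = (\<Union>n\<in>{t<..}. cyl n (\<lambda>t'. if t' = t then A else UNIV))"
      by (auto simp: B(1) cyl_def space_measure_of_conv)
    moreover have "cyl n (\<lambda>t'. if t' = t then A else UNIV) \<in> sets ?SG" for n
    proof -
      have "cyl n (\<lambda>t'. if t' = t then A else UNIV) = space M \<inter> cyl n (\<lambda>t'. if t' = t then A else UNIV)"
        by (auto simp: cyl_def)
      also have "\<dots> \<in> G"
        using B(2) sets.top[of N] by (intro GI) (auto simp: sp)
      finally show ?thesis unfolding setsSG by (rule sigma_sets.Basic)
    qed
    ultimately show "s -` B \<inter> space ?SG \<in> sets ?SG" by auto
  qed auto
  have sets_H_G: "sets H = sigma_sets (space M) G"
  proof (rule antisym[OF _ G_sub])
    have "Defs.events (space M) list_borel s \<subseteq> sets ?SG"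
      using events_subset_sets[OF s_SG] by (simp add: space_measure_of_conv)
    then have "sets N \<union> Defs.events (space M) list_borel s \<subseteq> sets ?SG"
      using N_in by blast
    from sets.sigma_sets_subset[OF this] show "sets H \<subseteq> sigma_sets (space M) G"
      by (simp add: sets_H setsSG space_measure_of_conv)
  qed
  have "Int_stable G"
  proof (rule Int_stableI)
    fix a b assume "a \<in> G" "b \<in> G"
    then obtain E n A E' n' A' where a: "a = E \<inter> cyl n A" "E \<in> sets N" "\<forall>t<n. A t \<in> sets borel"
      and b: "b = E' \<inter> cyl n' A'" "E' \<in> sets N" "\<forall>t<n'. A' t \<in> sets borel"
      unfolding G_def by blast
    show "a \<inter> b \<in> G"
    proof (cases "n = n'")
      case True
      then have "a \<inter> b = (E \<inter> E') \<inter> cyl n (\<lambda>t. A t \<inter> A' t)"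
        by (auto simp: a(1) b(1) cyl_def)
      moreover have "(E \<inter> E') \<inter> cyl n (\<lambda>t. A t \<inter> A' t) \<in> G"
        using a b True by (intro GI) auto
      ultimately show ?thesis by simp
    next
      case False
      then have "a \<inter> b = {} \<inter> cyl n A" by (auto simp: a(1) b(1) cyl_def)
      then show ?thesis using GI[OF sets.empty_sets a(3)] by simp
    qed
  qed
  have gM[measurable]: "g \<in> borel_measurable M"
    using measurable_from_subalg[OF HM] g by (simp add: H_def)
  \<comment> \<open>On \<open>H\<close>, the event \<open>E\<close> of \<open>F\<close> has the same conditional probability as on \<open>N\<close>.\<close>
  have same: "(\<integral>\<^sup>+\<omega>. indicator E \<omega> * g \<omega> \<partial>M) = (\<integral>\<^sup>+\<omega>. nn_cond_exp M N (indicator E) \<omega> * g \<omega> \<partial>M)"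
    if E: "E \<in> sets F" for E
  proof (rule nn_integral_determined_by_subalgebra[OF HM])
    have EM[measurable]: "E \<in> sets M" using E FM by blast
    let ?\<pi> = "nn_cond_exp M N (indicator E)"
    show piM: "?\<pi> \<in> borel_measurable M" by (rule borel_measurable_nn_cond_exp2)
    show "g \<in> borel_measurable H" using g by (simp add: H_def)
    fix B assume "B \<in> sets H"
    show "(\<integral>\<^sup>+\<omega>. indicator E \<omega> * indicator B \<omega> \<partial>M) = (\<integral>\<^sup>+\<omega>. ?\<pi> \<omega> * indicator B \<omega> \<partial>M)"
    proof (rule nn_integral_determined_by_generator[OF sets_H_G \<open>Int_stable G\<close> GM _ piM _ _ _ _ \<open>B \<in> sets H\<close>])
      show "range (\<lambda>n. space M \<inter> cyl n (\<lambda>_. UNIV)) \<subseteq> G"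
        using sets.top[of N] by (auto simp: sp intro!: GI)
      show "(\<Union>n. space M \<inter> cyl n (\<lambda>_. UNIV)) = space M" by (auto simp: cyl_def)
      show "(\<integral>\<^sup>+\<omega>. indicator E \<omega> \<partial>M) \<noteq> \<infinity>" by simp
      fix D assume "D \<in> G"
      then obtain E' n A where D: "D = E' \<inter> cyl n A" and E': "E' \<in> sets N" and A: "\<forall>t<n. A t \<in> sets borel"
        unfolding G_def by blast
      define l where "l = {\<omega> \<in> space M. length (s \<omega>) = n}"
      define q where "q = (\<Prod>t<n. measure Q {q\<in>space Q. \<xi> q \<in> A t})"
      have q: "0 \<le> q" unfolding q_def by (intro prod_nonneg) auto
      have factor: "prob (C \<inter> cyl n A) = q * prob (C \<inter> l)" if "C \<in> sets F" for C
      proof -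
        have "C \<inter> cyl n A = {\<omega>\<in>C. length (s \<omega>) = n \<and> (\<forall>t<n. s \<omega> ! t \<in> A t)}"
          "C \<inter> l = {\<omega>\<in>C. length (s \<omega>) = n}"
          using sets.sets_into_space[OF that] by (auto simp: cyl_def l_def sp)
        then show ?thesis
          using fresh that A by (simp add: fresh_samples_def q_def mult.commute)
      qed
      have l: "l \<in> sets N" unfolding l_def by (rule lenN)
      have lM: "l \<in> sets M" and E'F: "E' \<in> sets F" using l NF FM E' by auto
      have cM: "cyl n A \<in> sets M" by (rule cylM[OF A])
      have "(\<integral>\<^sup>+\<omega>. indicator E \<omega> * indicator D \<omega> \<partial>M) = (\<integral>\<^sup>+\<omega>. indicator (cyl n A) \<omega> * indicator (E \<inter> E') \<omega> \<partial>M)"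
        by (intro nn_integral_cong) (auto simp: D split: split_indicator)
      also have "\<dots> = ennreal q * (\<integral>\<^sup>+\<omega>. indicator l \<omega> * indicator (E \<inter> E') \<omega> \<partial>M)"
        by (rule nn_integral_event_factor[OF F _ cM lM q factor]) (use E E'F in auto)
      also have "(\<integral>\<^sup>+\<omega>. indicator l \<omega> * indicator (E \<inter> E') \<omega> \<partial>M) = (\<integral>\<^sup>+\<omega>. indicator (l \<inter> E') \<omega> * indicator E \<omega> \<partial>M)"
        by (intro nn_integral_cong) (auto split: split_indicator)
      also have "\<dots> = (\<integral>\<^sup>+\<omega>. indicator (l \<inter> E') \<omega> * ?\<pi> \<omega> \<partial>M)"
        by (rule N.nn_cond_exp_intg[symmetric]) (use l E' in auto)
      also have "\<dots> = (\<integral>\<^sup>+\<omega>. indicator l \<omega> * (?\<pi> \<omega> * indicator E' \<omega>) \<partial>M)"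
        by (intro nn_integral_cong) (auto split: split_indicator)
      also have "ennreal q * \<dots> = (\<integral>\<^sup>+\<omega>. indicator (cyl n A) \<omega> * (?\<pi> \<omega> * indicator E' \<omega>) \<partial>M)"
      proof (rule nn_integral_event_factor[OF F _ cM lM q factor, symmetric])
        have "(\<lambda>\<omega>. ?\<pi> \<omega> * indicator E' \<omega>) \<in> borel_measurable N" using E' by measurable
        then show "(\<lambda>\<omega>. ?\<pi> \<omega> * indicator E' \<omega>) \<in> borel_measurable F"
          by (rule measurable_from_subalg[OF N])
      qed
      also have "\<dots> = (\<integral>\<^sup>+\<omega>. ?\<pi> \<omega> * indicator D \<omega> \<partial>M)"
        by (intro nn_integral_cong) (auto simp: D split: split_indicator)
      finally show "(\<integral>\<^sup>+\<omega>. indicator E \<omega> * indicator D \<omega> \<partial>M) = (\<integral>\<^sup>+\<omega>. ?\<pi> \<omega> * indicator D \<omega> \<partial>M)" .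
    qed auto
  qed (use that FM in auto)
  have "AE \<omega> in M. nn_cond_exp M N g \<omega> = nn_cond_exp M F g \<omega>"
  proof (rule F.nn_cond_exp_charact)
    show "nn_cond_exp M N g \<in> borel_measurable F"
      by (rule measurable_from_subalg[OF N borel_measurable_nn_cond_exp])
    fix E assume E: "E \<in> sets F"
    have EM[measurable]: "E \<in> sets M" using E FM by blast
    let ?\<pi> = "nn_cond_exp M N (indicator E)"
    have "(\<integral>\<^sup>+\<omega>\<in>E. g \<omega> \<partial>M) = (\<integral>\<^sup>+\<omega>. indicator E \<omega> * g \<omega> \<partial>M)"
      by (simp add: mult.commute)
    also have "\<dots> = (\<integral>\<^sup>+\<omega>. ?\<pi> \<omega> * g \<omega> \<partial>M)" by (rule same[OF E])
    also have "\<dots> = (\<integral>\<^sup>+\<omega>. ?\<pi> \<omega> * nn_cond_exp M N g \<omega> \<partial>M)"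
      by (rule N.nn_cond_exp_intg[symmetric]) auto
    also have "\<dots> = (\<integral>\<^sup>+\<omega>. nn_cond_exp M N g \<omega> * ?\<pi> \<omega> \<partial>M)"
      by (simp add: mult.commute)
    also have "\<dots> = (\<integral>\<^sup>+\<omega>. nn_cond_exp M N g \<omega> * indicator E \<omega> \<partial>M)"
      by (rule N.nn_cond_exp_intg) auto
    finally show "(\<integral>\<^sup>+\<omega>\<in>E. g \<omega> \<partial>M) = (\<integral>\<^sup>+\<omega>\<in>E. nn_cond_exp M N g \<omega> \<partial>M)" .
  qed (rule gM)
  then show ?thesis by eventually_elim simp
qed

section \<open>The random scheme\<close>

locale async_game = potential_game own X f L w P U
  for own :: "'c::finite \<Rightarrow> 'i::finite" and X f L w P U +
  fixes \<mu> p :: "'i \<Rightarrow> real" and Q :: "'q measure" and \<xi> :: "'q \<Rightarrow> real ^ 'd::finite" and M :: "'o measure"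
    and x :: "nat \<Rightarrow> 'o \<Rightarrow> real ^ 'c" and idx :: "nat \<Rightarrow> 'o \<Rightarrow> 'i"
    and smp :: "'i \<Rightarrow> nat \<Rightarrow> 'o \<Rightarrow> (real ^ 'd) list" and d :: "'i \<Rightarrow> 'i \<Rightarrow> nat \<Rightarrow> 'o \<Rightarrow> nat"
    and \<epsilon> :: "'i \<Rightarrow> nat \<Rightarrow> 'o \<Rightarrow> real ^ 'c" and \<tau> :: nat
  assumes scheme: "async_scheme own X f \<mu> Q \<xi> M p x idx smp d \<epsilon>"
    and A3: "assumption_A3 M x idx smp d \<epsilon> \<tau>"
    and mu: "\<And>i. \<mu> i > L i / 2 + sqrt 2 * real \<tau> * L i / 2 *
                ((avg L / L i) * (avg w / w i) + (L i / avg L) * (w i / avg w))"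
begin

abbreviation "\<F>' \<equiv> past M x idx smp d"
abbreviation "\<I> \<equiv> player_info M x idx smp d"
abbreviation "\<F> \<equiv> past_delays M x idx smp d"

text \<open>
  \<open>\<S> i k\<close> is the information that determines the error of player \<open>i\<close> at time \<open>k\<close>.
\<close>

abbreviation "\<S> i k \<equiv> sigma (space M) (sets (\<I> i k) \<union> events (space M) list_borel (smp i k))"
abbreviation "picked i k \<equiv> {\<omega> \<in> space M. idx k \<omega> = i}"
abbreviation "res i k \<omega> \<equiv> prox own X f \<mu> i (delayed own x d i k \<omega>) - proj own i (x k \<omega>)"
abbreviation "err k \<omega> \<equiv> \<epsilon> (idx k \<omega>) (Suc k) \<omega>"

lemma prob_space_M: "prob_space M"
  using scheme by (simp add: async_scheme_def)

sublocale M: prob_space M by (rule prob_space_M)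

lemma
  shows p_pos: "0 < p i"
    and idx_measurable: "idx k \<in> M \<rightarrow>\<^sub>M count_space UNIV"
    and idx_prob: "measure M (picked i k) = p i"
    and fresh: "fresh_samples M (\<F> k) Q \<xi> (smp i k)"
    and length_measurable: "(\<lambda>\<omega>. length (smp i k \<omega>)) \<in> \<I> i k \<rightarrow>\<^sub>M count_space UNIV"
    and d_measurable: "d i j k \<in> M \<rightarrow>\<^sub>M count_space UNIV"
    and error_measurable: "\<epsilon> i (Suc k) \<in> borel_measurable (\<S> i k)"
    and x0_measurable: "x 0 \<in> borel_measurable M"
  using scheme by (simp_all add: async_scheme_def)

lemma
  shows picked_indep: "1 \<le> k \<Longrightarrow> M.indep_set (events (space M) (count_space UNIV) (idx k)) (sets (\<F> k))"
    and errors_cond_summable: "AE \<omega> in M.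
        (\<Sum>k. nn_cond_exp M (\<F> (Suc k)) (\<lambda>\<omega>. ennreal (norm (\<epsilon> i (Suc (Suc k)) \<omega>))) \<omega>) < \<infinity>"
  using A3 by (simp_all add: assumption_A3_def)

lemma trajectory:
  assumes "\<omega> \<in> space M"
  shows "trajectory own X f L w P U \<mu> \<tau> (\<lambda>k. x k \<omega>) (\<lambda>i k. delayed own x d i k \<omega>) (\<lambda>k. idx k \<omega>)
     (\<lambda>i j k. d i j k \<omega>) (\<lambda>k. err k \<omega>)"
proof
  show "0 < \<tau>" and "\<And>i j k. d i j k \<omega> \<le> \<tau>"
    using A3 assms by (simp_all add: assumption_A3_def)
  show "x 0 \<omega> \<in> \<G>" and "\<And>i k. d i i k \<omega> = 0"
    using scheme assms by (simp_all add: async_scheme_def)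
  have "\<forall>k. \<forall>\<omega>\<in>space M. \<forall>i. (if idx k \<omega> = i
         then proj own i (x (Suc k) \<omega>) = prox own X f \<mu> i (delayed own x d i k \<omega>) + \<epsilon> i (Suc k) \<omega> \<and>
              proj own i (x (Suc k) \<omega>) \<in> X i
         else proj own i (x (Suc k) \<omega>) = proj own i (x k \<omega>))"
    using scheme unfolding async_scheme_def by (elim conjE)
  note up = spec[OF bspec[OF spec[OF this] assms]]
  show "proj own (idx k \<omega>) (x (Suc k) \<omega>) = prox own X f \<mu> (idx k \<omega>) (delayed own x d (idx k \<omega>) k \<omega>) + err k \<omega>"
    and "proj own (idx k \<omega>) (x (Suc k) \<omega>) \<in> X (idx k \<omega>)" for k
    using up[of k "idx k \<omega>"] unfolding if_P[OF refl] by blast+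
  show "proj own i (x (Suc k) \<omega>) = proj own i (x k \<omega>)" if "i \<noteq> idx k \<omega>" for i k
    using up[of k i] unfolding if_not_P[OF not_sym[OF that]] .
qed (use mu in \<open>auto simp: delayed_def\<close>)

lemmas x_feasible = trajectory.x_feasible[OF trajectory]
lemmas y_feasible = trajectory.y_feasible[OF trajectory]

section \<open>The information structure\<close>

lemma smp_measurable: "smp i k \<in> M \<rightarrow>\<^sub>M list_borel"
  using fresh by (simp add: fresh_samples_def)

lemma past_generator: "events (space M) borel (x 0) \<union>
        (\<Union>l<k. events (space M) (count_space UNIV) (idx l) \<union>
               events (space M) list_borel (\<lambda>\<omega>. smp (idx l \<omega>) l \<omega>) \<union>
               (\<Union>j. events (space M) (count_space UNIV) (\<lambda>\<omega>. d (idx l \<omega>) j l \<omega>))) \<subseteq> sets M"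
  by (intro Un_least UN_least events_subset_sets x0_measurable idx_measurable
      measurable_compose_countable[OF smp_measurable] measurable_compose_countable[OF d_measurable])

lemma past_subalgebra: "subalgebra M (\<F>' k)"
  unfolding past_def by (rule subalgebra_sigma[OF past_generator])

lemma past_basic:
  shows "events (space M) borel (x 0) \<subseteq> sets (\<F>' k)"
    and "l < k \<Longrightarrow> events (space M) (count_space UNIV) (idx l) \<subseteq> sets (\<F>' k)"
    and "l < k \<Longrightarrow> events (space M) list_borel (\<lambda>\<omega>. smp (idx l \<omega>) l \<omega>) \<subseteq> sets (\<F>' k)"
    and "l < k \<Longrightarrow> events (space M) (count_space UNIV) (\<lambda>\<omega>. d (idx l \<omega>) j l \<omega>) \<subseteq> sets (\<F>' k)"
  unfolding past_def by (rule order_trans[OF _ subalgebra_sigma(2)[OF past_generator]], blast)+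

lemma past_mono: "k \<le> l \<Longrightarrow> sets (\<F>' k) \<subseteq> sets (\<F>' l)"
  unfolding past_def[of _ _ _ _ _ k]
proof (rule sets_sigma_subset[OF past_subalgebra])
  assume "k \<le> l"
  then show "events (space M) borel (x 0) \<union>
        (\<Union>l<k. events (space M) (count_space UNIV) (idx l) \<union>
               events (space M) list_borel (\<lambda>\<omega>. smp (idx l \<omega>) l \<omega>) \<union>
               (\<Union>j. events (space M) (count_space UNIV) (\<lambda>\<omega>. d (idx l \<omega>) j l \<omega>))) \<subseteq> sets (\<F>' l)"
    by (intro Un_least UN_least past_basic) auto
qed

lemma info_generator: "sets (\<F>' k) \<union> (\<Union>j. events (space M) (count_space UNIV) (d i j k)) \<subseteq> sets M"
  using past_subalgebra[of k]
  by (intro Un_least UN_least events_subset_sets d_measurable) (simp add: subalgebra_def)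

lemma info_subalgebra: "subalgebra M (\<I> i k)"
  unfolding player_info_def by (rule subalgebra_sigma[OF info_generator])

lemma info_basic: "sets (\<F>' k) \<subseteq> sets (\<I> i k)"
    "events (space M) (count_space UNIV) (d i j k) \<subseteq> sets (\<I> i k)"
  unfolding player_info_def by (rule order_trans[OF _ subalgebra_sigma(2)[OF info_generator]], blast)+

lemma delays_generator: "sets (\<F>' k) \<union> (\<Union>i. \<Union>j. events (space M) (count_space UNIV) (d i j k)) \<subseteq> sets M"
  using past_subalgebra[of k]
  by (intro Un_least UN_least events_subset_sets d_measurable) (simp add: subalgebra_def)

lemma delays_subalgebra: "subalgebra M (\<F> k)"
  unfolding past_delays_def by (rule subalgebra_sigma[OF delays_generator])

lemma info_subset_delays: "sets (\<I> i k) \<subseteq> sets (\<F> k)"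
  unfolding player_info_def
proof (rule sets_sigma_subset[OF delays_subalgebra])
  show "sets (\<F>' k) \<union> (\<Union>j. events (space M) (count_space UNIV) (d i j k)) \<subseteq> sets (\<F> k)"
    unfolding past_delays_def by (rule order_trans[OF _ subalgebra_sigma(2)[OF delays_generator]]) blast
qed

lemma sample_generator: "sets (\<I> i k) \<union> events (space M) list_borel (smp i k) \<subseteq> sets M"
  using info_subalgebra[of i k]
  by (intro Un_least events_subset_sets smp_measurable) (simp add: subalgebra_def)

lemma sample_subalgebra: "subalgebra M (\<S> i k)"
  by (rule subalgebra_sigma[OF sample_generator])

lemma info_subset_sample: "sets (\<I> i k) \<subseteq> sets (\<S> i k)"
  by (rule order_trans[OF _ subalgebra_sigma(2)[OF sample_generator]]) blast

lemma space_info [simp]: "space (\<F>' k) = space M" "space (\<I> i k) = space M" "space (\<F> k) = space M" "space (\<S> i k) = space M"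
  using past_subalgebra[of k] info_subalgebra[of i k] delays_subalgebra[of k] sample_subalgebra[of i k]
  by (simp_all add: subalgebra_def)

lemma subalgebra_info:
  "subalgebra (\<I> i k) (\<F>' k)" "subalgebra (\<F> k) (\<I> i k)" "subalgebra (\<S> i k) (\<I> i k)" "subalgebra (\<S> i k) (\<F>' k)"
  "k \<le> l \<Longrightarrow> subalgebra (\<F>' l) (\<F>' k)"
  using info_basic(1)[of k i] info_subset_delays[of i k] info_subset_sample[of i k] past_mono[of k l]
  unfolding subalgebra_def space_info by (simp_all only: simp_thms)

lemma picked_past: "picked i k \<in> sets (\<F>' (Suc k))"
proof -
  have "picked i k \<in> events (space M) (count_space UNIV) (idx k)"
    by (auto simp: events_def intro!: exI[of _ "{i}"])
  then show ?thesis using past_basic(2)[of k "Suc k"] by blast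
qed

lemma picked_sets: "picked i k \<in> sets M"
  using picked_past past_subalgebra by (auto simp: subalgebra_def)

text \<open>
  When player \<open>i\<close> is picked, the delays and samples of \<open>i\<close> are recorded in \<open>\<F>'_{k+1}\<close>.
\<close>

lemma sample_trace:
  assumes "E \<in> sets (\<S> i k)"
  shows "E \<inter> picked i k \<in> sets (\<F>' (Suc k))"
proof -
  have picked_cong: "Z -` B \<inter> space M \<inter> picked i k \<in> sets (\<F>' (Suc k))"
    if "events (space M) N Z' \<subseteq> sets (\<F>' (Suc k))" "B \<in> sets N" "\<And>\<omega>. \<omega> \<in> picked i k \<Longrightarrow> Z \<omega> = Z' \<omega>"
    for Z Z' :: "'o \<Rightarrow> 'z" and N B
  proof -
    have "Z -` B \<inter> space M \<inter> picked i k = (Z' -` B \<inter> space M) \<inter> picked i k"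
      using that(3) by auto
    moreover have "Z' -` B \<inter> space M \<in> sets (\<F>' (Suc k))"
      using that(1,2) by (auto simp: events_def)
    ultimately show ?thesis using picked_past by simp
  qed
  have info: "A \<inter> picked i k \<in> sets (\<F>' (Suc k))" if A: "A \<in> sets (\<I> i k)" for A
  proof (rule sigma_sets_trace[OF _ _ picked_past])
    show "A \<in> sigma_sets (space M) (sets (\<F>' k) \<union> (\<Union>j. events (space M) (count_space UNIV) (d i j k)))"
      using A info_generator[of k i] sets.sets_into_space[of _ M]
      unfolding player_info_def by (subst (asm) sets_measure_of) auto
    fix B assume "B \<in> sets (\<F>' k) \<union> (\<Union>j. events (space M) (count_space UNIV) (d i j k))"
    then show "B \<inter> picked i k \<in> sets (\<F>' (Suc k))"
    proof
      assume "B \<in> sets (\<F>' k)"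
      then show ?thesis using past_mono[of k "Suc k"] picked_past by auto
    next
      assume "B \<in> (\<Union>j. events (space M) (count_space UNIV) (d i j k))"
      then obtain j C where "B = d i j k -` C \<inter> space M" by (auto simp: events_def)
      then show ?thesis
        using picked_cong[OF past_basic(4)[of k "Suc k" j], of C "d i j k"] by auto
    qed
  qed auto
  show ?thesis
  proof (rule sigma_sets_trace[OF _ _ picked_past])
    show "E \<in> sigma_sets (space M) (sets (\<I> i k) \<union> events (space M) list_borel (smp i k))"
      using assms sample_generator[of i k] sets.sets_into_space[of _ M] by (subst (asm) sets_measure_of) auto
    fix B assume "B \<in> sets (\<I> i k) \<union> events (space M) list_borel (smp i k)"
    then show "B \<inter> picked i k \<in> sets (\<F>' (Suc k))"
    proof
      assume "B \<in> events (space M) list_borel (smp i k)"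
      then obtain C where "B = smp i k -` C \<inter> space M" "C \<in> sets list_borel" by (auto simp: events_def)
      then show ?thesis
        using picked_cong[OF past_basic(3)[of k "Suc k"], of C "smp i k"] by auto
    qed (rule info)
  qed auto
qed

lemma d_info: "d i j k \<in> \<I> i k \<rightarrow>\<^sub>M count_space UNIV"
  by (rule measurable_from_events[OF info_subalgebra info_basic(2) d_measurable])

lemma delayed_info:
  assumes "\<And>l. l \<le> k \<Longrightarrow> x l \<in> borel_measurable (\<F>' k)"
  shows "delayed own x d i k \<in> borel_measurable (\<I> i k)"
proof -
  have "(\<lambda>\<omega>. proj own j (x (k - d i j k \<omega>) \<omega>)) \<in> borel_measurable (\<I> i k)" for j
  proof (rule measurable_compose_countable[OF _ d_info])
    fix n
    have "x (k - n) \<in> borel_measurable (\<I> i k)"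
      by (rule measurable_from_subalg[OF subalgebra_info(1) assms]) simp
    then show "(\<lambda>\<omega>. proj own j (x (k - n) \<omega>)) \<in> borel_measurable (\<I> i k)"
      by (rule borel_measurable_compose_on[OF _ _ continuous_on_proj]) auto
  qed
  then have "(\<lambda>\<omega>. \<Sum>j\<in>UNIV. proj own j (x (k - d i j k \<omega>) \<omega>)) \<in> borel_measurable (\<I> i k)"
    by (intro borel_measurable_sum)
  moreover have "delayed own x d i k \<omega> = (\<Sum>j\<in>UNIV. proj own j (x (k - d i j k \<omega>) \<omega>))" for \<omega>
    by (subst sum_proj[of own, symmetric]) (auto intro!: sum.cong simp: vec_eq_iff delayed_def)
  ultimately show ?thesis by (simp cong: measurable_cong)
qed

lemma prox_continuous: "continuous_on \<G> (prox own X f \<mu> i)"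
proof -
  have "0 < \<mu> i"
  proof -
    obtain \<omega> where "\<omega> \<in> space M" using M.not_empty by blast
    from trajectory.mu_pos[OF trajectory[OF this]] show ?thesis .
  qed
  then show ?thesis
    using prox_lipschitz[of _ _ \<mu> i] L_pos[of i]
    by (intro lipschitz_on_continuous_on[of "(\<mu> i + L i) / \<mu> i"] lipschitz_onI) (auto simp: dist_norm)
qed

lemma prox_info:
  assumes "\<And>l. l \<le> k \<Longrightarrow> x l \<in> borel_measurable (\<F>' k)"
  shows "(\<lambda>\<omega>. prox own X f \<mu> i (delayed own x d i k \<omega>)) \<in> borel_measurable (\<I> i k)"
  by (rule borel_measurable_compose_on[OF delayed_info[OF assms] _ prox_continuous]) (auto intro: y_feasible)

text \<open>
  The new iterate is computed from information that only becomes part of \<open>\<F>'_{k+1}\<close> on the event that the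
  player is picked, hence the decomposition over \<open>i\<close> and the use of \<open>sample_trace\<close>.
\<close>

lemma x_adapted: "l \<le> k \<Longrightarrow> x l \<in> borel_measurable (\<F>' k)"
proof (induction l arbitrary: k rule: less_induct)
  case (less l)
  show ?case
  proof (cases l)
    case 0
    then show ?thesis
      using measurable_from_events[OF past_subalgebra past_basic(1) x0_measurable] by simp
  next
    case (Suc m)
    have past: "\<And>l. l \<le> m \<Longrightarrow> x l \<in> borel_measurable (\<F>' m)"
      using less.IH Suc by auto
    define z where "z i \<omega> = x m \<omega> + proj own i (prox own X f \<mu> i (delayed own x d i m \<omega>) + \<epsilon> i (Suc m) \<omega> - x m \<omega>)" for i \<omega>
    have z: "z i \<in> borel_measurable (\<S> i m)" for i
    proof -
      have 1: "x m \<in> borel_measurable (\<S> i m)"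
        by (rule measurable_from_subalg[OF subalgebra_info(4) past]) simp
      have 2: "(\<lambda>\<omega>. prox own X f \<mu> i (delayed own x d i m \<omega>)) \<in> borel_measurable (\<S> i m)"
        by (rule measurable_from_subalg[OF subalgebra_info(3) prox_info[OF past]])
      show ?thesis
        unfolding z_def
        by (intro borel_measurable_add 1 borel_measurable_compose_on[OF _ _ continuous_on_proj[of UNIV]]
            borel_measurable_diff 2 error_measurable) auto
    qed
    have xz: "x (Suc m) \<omega> = z (idx m \<omega>) \<omega>" if "\<omega> \<in> space M" for \<omega>
      using trajectory.x_Suc[OF trajectory[OF that], of m] by (auto simp: z_def vec_eq_iff)
    have "x (Suc m) \<in> borel_measurable (\<F>' (Suc m))"
    proof (rule measurableI)
      fix B :: "(real ^ 'c) set" assume B: "B \<in> sets borel"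
      have "x (Suc m) -` B \<inter> space (\<F>' (Suc m)) = (\<Union>i. (z i -` B \<inter> space (\<S> i m)) \<inter> picked i m)"
        by (auto simp: xz)
      also have "\<dots> \<in> sets (\<F>' (Suc m))"
        by (intro sets.finite_UN sample_trace measurable_sets[OF z B]) auto
      finally show "x (Suc m) -` B \<inter> space (\<F>' (Suc m)) \<in> sets (\<F>' (Suc m))" .
    qed simp
    then show ?thesis
      using measurable_from_subalg[OF subalgebra_info(5)] less.prems Suc by blast
  qed
qed

lemma x_measurable: "x k \<in> borel_measurable M"
  by (rule measurable_from_subalg[OF past_subalgebra x_adapted[OF order_refl]])

lemma residual_info: "res i k \<in> borel_measurable (\<I> i k)"
proof -
  have "x k \<in> borel_measurable (\<I> i k)"
    by (rule measurable_from_subalg[OF subalgebra_info(1) x_adapted]) simp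
  then have "(\<lambda>\<omega>. proj own i (x k \<omega>)) \<in> borel_measurable (\<I> i k)"
    by (rule borel_measurable_compose_on[OF _ _ continuous_on_proj]) auto
  with prox_info[OF x_adapted] show ?thesis by (rule borel_measurable_diff)
qed

section \<open>Almost sure summability\<close>

text \<open>
  The information of player \<open>i\<close> is part of \<open>\<F>_k\<close>, of which the choice of \<open>i_k\<close> is independent.
\<close>

lemma picked_factor:
  assumes "1 \<le> k" and v: "v \<in> borel_measurable (\<I> i k)"
  shows "(\<integral>\<^sup>+\<omega>. v \<omega> \<partial>M) = ennreal (1 / p i) * (\<integral>\<^sup>+\<omega>. (if \<omega> \<in> picked i k then v \<omega> else 0) \<partial>M)"
proof -
  have "M.prob (E \<inter> picked i k) = p i * M.prob (E \<inter> space M)" if "E \<in> sets (\<F> k)" for E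
  proof -
    have ev: "picked i k \<in> events (space M) (count_space UNIV) (idx k)"
      by (auto simp: events_def intro!: exI[of _ "{i}"])
    have "E \<inter> space M = E" using sets.sets_into_space[OF that] by auto
    then show ?thesis
      using M.indep_setD[OF picked_indep[OF assms(1)] ev that] idx_prob[of k i] by (simp add: Int_commute)
  qed
  from M.nn_integral_event_factor[OF delays_subalgebra measurable_from_subalg[OF subalgebra_info(2) v] picked_sets sets.top
        less_imp_le[OF p_pos] this]
  have "(\<integral>\<^sup>+\<omega>. indicator (picked i k) \<omega> * v \<omega> \<partial>M) = ennreal (p i) * (\<integral>\<^sup>+\<omega>. indicator (space M) \<omega> * v \<omega> \<partial>M)" .
  also have "(\<integral>\<^sup>+\<omega>. indicator (picked i k) \<omega> * v \<omega> \<partial>M) = (\<integral>\<^sup>+\<omega>. (if \<omega> \<in> picked i k then v \<omega> else 0) \<partial>M)"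
    by (intro nn_integral_cong) (auto split: split_indicator)
  also have "(\<integral>\<^sup>+\<omega>. indicator (space M) \<omega> * v \<omega> \<partial>M) = (\<integral>\<^sup>+\<omega>. v \<omega> \<partial>M)"
    by (intro nn_integral_cong) auto
  finally have "ennreal (1 / p i) * (\<integral>\<^sup>+\<omega>. (if \<omega> \<in> picked i k then v \<omega> else 0) \<partial>M)
      = (ennreal (1 / p i) * ennreal (p i)) * (\<integral>\<^sup>+\<omega>. v \<omega> \<partial>M)"
    by (simp add: mult.assoc)
  also have "ennreal (1 / p i) * ennreal (p i) = 1"
    using p_pos[of i] by (simp add: ennreal_mult[symmetric])
  finally show ?thesis by simp
qed

text \<open>
  Being picked has probability \<open>p_i > 0\<close> independently of player \<open>i\<close>'s information, so a series that is finite
  along the times at which \<open>i\<close> is picked is finite altogether. The terms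
  \<open>u\<close> are compared with \<open>v\<close> on average over past events, because \<open>v\<close> may be built from a
  conditional expectation of \<open>u\<close>. Time starts at \<open>1\<close>, where the independence of \<open>i_k\<close> sets in.
\<close>

lemma summable_if_picked:
  assumes v: "\<And>k. v k \<in> borel_measurable (\<I> i (Suc k))" and v1: "\<And>k \<omega>. v k \<omega> \<le> 1"
    and u: "\<And>k. u k \<in> borel_measurable M"
    and le: "\<And>k A. A \<in> sets (\<F>' (Suc k)) \<Longrightarrow>
      (\<integral>\<^sup>+\<omega>. u k \<omega> * indicator A \<omega> \<partial>M) \<le> (\<integral>\<^sup>+\<omega>. v k \<omega> * indicator A \<omega> \<partial>M)"
    and fin: "AE \<omega> in M. (\<Sum>k. if idx (Suc k) \<omega> = i then v k \<omega> else 0) < \<infinity>"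
  shows "AE \<omega> in M. (\<Sum>k. u k \<omega>) < (\<infinity>::ennreal)"
proof (rule M.summable_transfer[where F = "\<lambda>k. \<F>' (Suc k)" and
      v = "\<lambda>k \<omega>. if \<omega> \<in> picked i (Suc k) then v k \<omega> else 0"])
  show "(\<lambda>\<omega>. if \<omega> \<in> picked i (Suc k) then v k \<omega> else 0) \<in> borel_measurable (\<F>' (Suc (Suc k)))" for k
    by (rule measurable_if_trace[OF measurable_from_subalg[OF subalgebra_info(3) v] sample_trace _ picked_past]) simp_all
  show "AE \<omega> in M. (\<Sum>k. if \<omega> \<in> picked i (Suc k) then v k \<omega> else 0) < \<infinity>"
    using fin AE_space by eventually_elim simp
  show "(\<integral>\<^sup>+\<omega>. u k \<omega> * indicator A \<omega> \<partial>M)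
      \<le> ennreal (1 / p i) * (\<integral>\<^sup>+\<omega>. (if \<omega> \<in> picked i (Suc k) then v k \<omega> else 0) * indicator A \<omega> \<partial>M)"
    if A: "A \<in> sets (\<F>' (Suc k))" for k A
  proof -
    have "A \<in> sets (\<I> i (Suc k))" using A info_basic(1) by blast
    then have "(\<lambda>\<omega>. v k \<omega> * indicator A \<omega>) \<in> borel_measurable (\<I> i (Suc k))"
      using v[of k] by measurable
    from picked_factor[OF _ this]
    have "(\<integral>\<^sup>+\<omega>. v k \<omega> * indicator A \<omega> \<partial>M) = ennreal (1 / p i) *
        (\<integral>\<^sup>+\<omega>. (if \<omega> \<in> picked i (Suc k) then v k \<omega> * indicator A \<omega> else 0) \<partial>M)" by simp
    also have "(\<integral>\<^sup>+\<omega>. (if \<omega> \<in> picked i (Suc k) then v k \<omega> * indicator A \<omega> else 0) \<partial>M)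
       = (\<integral>\<^sup>+\<omega>. (if \<omega> \<in> picked i (Suc k) then v k \<omega> else 0) * indicator A \<omega> \<partial>M)"
      by (intro nn_integral_cong) simp
    finally show ?thesis using le[OF A] by simp
  qed
qed (auto intro: past_subalgebra u v1 past_mono[THEN subsetD])

text \<open>
  Conditioning on the information of player \<open>i\<close> instead of \<open>\<F>_k\<close> changes nothing by
  \<open>cond_exp_fresh_samples\<close>, and makes the conditional expectations accessible to
  \<open>summable_if_picked\<close>.
\<close>

lemma errors_summable: "AE \<omega> in M. summable (\<lambda>k. norm (\<epsilon> i k \<omega>))"
proof -
  let ?e = "\<lambda>k \<omega>. ennreal (norm (\<epsilon> i (Suc (Suc k)) \<omega>))"
  let ?b = "\<lambda>k. nn_cond_exp M (\<I> i (Suc k)) (?e k)"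
  have eS: "?e k \<in> borel_measurable (\<S> i (Suc k))" for k
    using error_measurable by measurable
  have eM: "?e k \<in> borel_measurable M" for k
    by (rule measurable_from_subalg[OF sample_subalgebra eS])
  have "AE \<omega> in M. nn_cond_exp M (\<F> (Suc k)) (?e k) \<omega> = ?b k \<omega>" for k
    by (rule M.cond_exp_fresh_samples[OF delays_subalgebra subalgebra_info(2) fresh length_measurable eS])
  then have "AE \<omega> in M. \<forall>k. nn_cond_exp M (\<F> (Suc k)) (?e k) \<omega> = ?b k \<omega>"
    by (simp add: AE_all_countable)
  with errors_cond_summable[of i]
  have fin: "AE \<omega> in M. (\<Sum>k. if idx (Suc k) \<omega> = i then min (?b k \<omega>) 1 else 0) < \<infinity>"
  proof eventually_elim
    case (elim \<omega>)
    have "(\<Sum>k. if idx (Suc k) \<omega> = i then min (?b k \<omega>) 1 else 0) \<le> (\<Sum>k. ?b k \<omega>)"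
      by (intro suminf_le) auto
    also have "\<dots> < \<infinity>" using elim by simp
    finally show ?case .
  qed
  have "AE \<omega> in M. (\<Sum>k. min (?e k \<omega>) 1) < \<infinity>"
  proof (rule summable_if_picked[OF _ _ _ _ fin])
    show "(\<lambda>\<omega>. min (?b k \<omega>) 1) \<in> borel_measurable (\<I> i (Suc k))" for k
      by (intro borel_measurable_min borel_measurable_nn_cond_exp) simp
    show "(\<lambda>\<omega>. min (?e k \<omega>) 1) \<in> borel_measurable M" for k
      by (intro borel_measurable_min eM) simp
    show "(\<integral>\<^sup>+\<omega>. min (?e k \<omega>) 1 * indicator A \<omega> \<partial>M) \<le> (\<integral>\<^sup>+\<omega>. min (?b k \<omega>) 1 * indicator A \<omega> \<partial>M)"
      if "A \<in> sets (\<F>' (Suc k))" for k A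
      by (rule M.nn_integral_min_cond_exp_le[OF info_subalgebra eM]) (use that info_basic(1) in blast)
  qed simp
  then show ?thesis
  proof eventually_elim
    case (elim \<omega>)
    then have "summable (\<lambda>k. norm (\<epsilon> i (Suc (Suc k)) \<omega>))"
      by (intro suminf_min_one_finite_imp_summable) auto
    then show ?case by (simp only: summable_Suc_iff[of "\<lambda>k. norm (\<epsilon> i (Suc k) \<omega>)"]
          summable_Suc_iff[of "\<lambda>k. norm (\<epsilon> i k \<omega>)"])
  qed
qed

lemma picked_errors_summable: "AE \<omega> in M. summable (\<lambda>k. norm (err k \<omega>))"
proof -
  have "AE \<omega> in M. \<forall>i. summable (\<lambda>k. norm (\<epsilon> i k \<omega>))"
    using errors_summable by (simp add: AE_all_countable)
  then show ?thesis
  proof eventually_elim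
    case (elim \<omega>)
    have "summable (\<lambda>k. \<Sum>i\<in>UNIV. norm (\<epsilon> i (Suc k) \<omega>))"
      using elim by (intro summable_sum) (simp add: summable_Suc_iff[of "\<lambda>k. norm (\<epsilon> _ k \<omega>)"])
    then show ?case
      by (rule summable_comparison_test') (auto intro: member_le_sum[of _ UNIV "\<lambda>i. norm (\<epsilon> i _ \<omega>)"])
  qed
qed

text \<open>
  The pathwise bound controls the residuals of the picked players. Residuals are functions of the
  information of the player, so \<open>summable_if_picked\<close> extends the bound to all times.
\<close>

lemma residuals_summable: "AE \<omega> in M. summable (\<lambda>k. (norm (res i k \<omega>))\<^sup>2)"
proof -
  obtain D where D: "D > 0" "\<And>i a b. a \<in> X i \<Longrightarrow> b \<in> X i \<Longrightarrow> norm (a - b) \<le> D"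
    using X_diameter by blast
  let ?r = "\<lambda>k \<omega>. (norm (res i (Suc k) \<omega>) / D)\<^sup>2"
  let ?u = "\<lambda>k \<omega>. min (ennreal (?r k \<omega>)) 1"
  have uI: "?u k \<in> borel_measurable (\<I> i (Suc k))" for k
    using residual_info[of i "Suc k"] by measurable
  have uM: "?u k \<in> borel_measurable M" for k
    by (rule measurable_from_subalg[OF info_subalgebra uI])
  have "AE \<omega> in M. (\<Sum>k. if idx (Suc k) \<omega> = i then ?u k \<omega> else 0) < \<infinity>"
    using picked_errors_summable AE_space
  proof eventually_elim
    case (elim \<omega>)
    interpret trajectory own X f L w P U \<mu> \<tau> "\<lambda>k. x k \<omega>" "\<lambda>i k. delayed own x d i k \<omega>" "\<lambda>k. idx k \<omega>"
        "\<lambda>i j k. d i j k \<omega>" "\<lambda>k. err k \<omega>"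
      by (rule trajectory[OF elim(2)])
    have "summable (\<lambda>k. (norm (res (idx (Suc k) \<omega>) (Suc k) \<omega>))\<^sup>2 / D\<^sup>2)"
      using picked_residuals_summable[OF elim(1)]
      by (intro summable_divide) (simp only: summable_Suc_iff[of "\<lambda>k. (norm (res (idx k \<omega>) k \<omega>))\<^sup>2"])
    then have s: "summable (\<lambda>k. (norm (res (idx (Suc k) \<omega>) (Suc k) \<omega>) / D)\<^sup>2)"
      by (simp add: power_divide)
    have "(\<Sum>k. if idx (Suc k) \<omega> = i then ?u k \<omega> else 0) \<le> (\<Sum>k. ennreal ((norm (res (idx (Suc k) \<omega>) (Suc k) \<omega>) / D)\<^sup>2))"
      by (intro suminf_le) auto
    also have "\<dots> = ennreal (\<Sum>k. (norm (res (idx (Suc k) \<omega>) (Suc k) \<omega>) / D)\<^sup>2)"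
      by (intro suminf_ennreal2 s) simp
    finally show ?case by (rule order_le_less_trans) simp
  qed
  from summable_if_picked[OF uI _ uM _ this]
  have "AE \<omega> in M. (\<Sum>k. ?u k \<omega>) < \<infinity>" by simp
  then show ?thesis
  proof eventually_elim
    case (elim \<omega>)
    then have "summable (\<lambda>k. ?r k \<omega>)"
      by (intro suminf_min_one_finite_imp_summable) auto
    then have "summable (\<lambda>k. D\<^sup>2 * ?r k \<omega>)" by (rule summable_mult)
    then have "summable (\<lambda>k. (norm (res i (Suc k) \<omega>))\<^sup>2)"
      using D(1) by (simp add: power_divide)
    then show ?case by (simp only: summable_Suc_iff[of "\<lambda>k. (norm (res i k \<omega>))\<^sup>2"])
  qed
qed

section \<open>Convergence\<close>

lemma gap_steps_vanish:
  "AE \<omega> in M. (\<lambda>k. gap own X P (x k \<omega>)) \<longlonglongrightarrow> 0 \<and> (\<lambda>k. x (Suc k) \<omega> - x k \<omega>) \<longlonglongrightarrow> 0"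
proof -
  have "AE \<omega> in M. \<forall>i. summable (\<lambda>k. (norm (res i k \<omega>))\<^sup>2)"
    using residuals_summable by (simp add: AE_all_countable)
  with picked_errors_summable AE_space show ?thesis
  proof eventually_elim
    case (elim \<omega>)
    with trajectory.gap_vanishes[OF trajectory[OF elim(2)]] trajectory.steps_vanish[OF trajectory[OF elim(2)]]
    show ?case by blast
  qed
qed

lemma limit_points_nash_AE:
  "AE \<omega> in M. \<forall>z r. strict_mono r \<and> (\<lambda>n. x (r n) \<omega>) \<longlonglongrightarrow> z \<longrightarrow> z \<in> nash own X f"
  using gap_steps_vanish AE_space
  by eventually_elim (use trajectory.limit_points_nash[OF trajectory] in blast)

lemma attracted_to_connected_set:
  "AE \<omega> in M. \<exists>C. C \<noteq> {} \<and> connected C \<and> C \<subseteq> nash own X f \<and> (\<lambda>k. infdist (x k \<omega>) C) \<longlonglongrightarrow> 0"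
  using gap_steps_vanish limit_points_nash_AE AE_space
proof eventually_elim
  case (elim \<omega>)
  let ?C = "{z. \<exists>r. strict_mono r \<and> (\<lambda>n. x (r n) \<omega>) \<longlonglongrightarrow> z}"
  have "?C \<noteq> {} \<and> connected ?C \<and> (\<lambda>k. infdist (x k \<omega>) ?C) \<longlonglongrightarrow> 0"
    using elim by (intro limit_set_connected_attracting[OF profiles_compact] x_feasible) auto
  moreover have "?C \<subseteq> nash own X f" using elim by auto
  ultimately show ?case by (intro exI[of _ ?C]) (elim conjE, intro conjI)
qed

lemma gap_expectation:
  shows "integrable M (\<lambda>\<omega>. gap own X P (x k \<omega>))" (is "integrable M (?g k)")
    and "(\<lambda>k. \<integral>\<omega>. gap own X P (x k \<omega>) \<partial>M) \<longlonglongrightarrow> 0"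
proof -
  have gm[measurable]: "?g k \<in> borel_measurable M" for k
    by (rule borel_measurable_compose_on[OF x_measurable x_feasible gap_continuous])
  have "bounded (gap own X P ` \<G>)"
    by (intro compact_imp_bounded compact_continuous_image gap_continuous profiles_compact)
  then obtain B where B: "\<And>z. z \<in> \<G> \<Longrightarrow> norm (gap own X P z) \<le> B"
    by (auto simp: bounded_iff)
  then have bound: "AE \<omega> in M. norm (?g k \<omega>) \<le> B" for k
    using x_feasible by (intro AE_I2) auto
  show "integrable M (?g k)"
    by (rule M.integrable_const_bound[OF bound gm])
  have "(\<lambda>k. \<integral>\<omega>. ?g k \<omega> \<partial>M) \<longlonglongrightarrow> (\<integral>\<omega>. 0 \<partial>M)"
  proof (rule integral_dominated_convergence[where w = "\<lambda>_. B"])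
    show "AE \<omega> in M. (\<lambda>k. ?g k \<omega>) \<longlonglongrightarrow> 0"
      using gap_steps_vanish by eventually_elim simp
  qed (use bound in auto)
  then show "(\<lambda>k. \<integral>\<omega>. ?g k \<omega> \<partial>M) \<longlonglongrightarrow> 0" by simp
qed

end

theorem corollary3:
  fixes own :: "'c::finite \<Rightarrow> 'i::finite"
    and X :: "'i \<Rightarrow> (real ^ 'c) set"
    and f :: "'i \<Rightarrow> real ^ 'c \<Rightarrow> real"
    and \<psi> :: "'i \<Rightarrow> real ^ 'c \<Rightarrow> real ^ 'd::finite \<Rightarrow> real"
    and Q :: "'q measure" and \<xi> :: "'q \<Rightarrow> real ^ 'd"
    and L w \<mu> p :: "'i \<Rightarrow> real"
    and P :: "real ^ 'c \<Rightarrow> real"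
    and M :: "'o measure"
    and x :: "nat \<Rightarrow> 'o \<Rightarrow> real ^ 'c"
    and idx :: "nat \<Rightarrow> 'o \<Rightarrow> 'i"
    and smp :: "'i \<Rightarrow> nat \<Rightarrow> 'o \<Rightarrow> (real ^ 'd) list"
    and d :: "'i \<Rightarrow> 'i \<Rightarrow> nat \<Rightarrow> 'o \<Rightarrow> nat"
    and \<epsilon> :: "'i \<Rightarrow> nat \<Rightarrow> 'o \<Rightarrow> real ^ 'c"
    and \<tau> :: nat
  assumes game: "stochastic_game own X f \<psi> Q \<xi>"
    and A1: "assumption_A1 own X f \<psi> Q \<xi> L"
    and A2: "weighted_potential own X f w P"
    and scheme: "async_scheme own X f \<mu> Q \<xi> M p x idx smp d \<epsilon>"
    and A3: "assumption_A3 M x idx smp d \<epsilon> \<tau>"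
    and mu: "\<And>i. \<mu> i > L i / 2 + sqrt 2 * real \<tau> * L i / 2 *
                ((avg L / L i) * (avg w / w i) + (L i / avg L) * (w i / avg w))"
  shows
    "(\<forall>i. AE \<omega> in M.
        summable (\<lambda>k. (norm (prox own X f \<mu> i (delayed own x d i k \<omega>) - proj own i (x k \<omega>)))\<^sup>2)) \<and>
     (AE \<omega> in M. \<forall>z r. strict_mono r \<and> (\<lambda>n. x (r n) \<omega>) \<longlonglongrightarrow> z \<longrightarrow> z \<in> nash own X f) \<and>
     (AE \<omega> in M. \<exists>C. C \<noteq> {} \<and> connected C \<and> C \<subseteq> nash own X f \<and>
        (\<lambda>k. infdist (x k \<omega>) C) \<longlonglongrightarrow> 0) \<and>
     (\<forall>k. integrable M (\<lambda>\<omega>. gap own X P (x k \<omega>))) \<and>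
     (\<lambda>k. \<integral>\<omega>. gap own X P (x k \<omega>) \<partial>M) \<longlonglongrightarrow> 0"
proof -
  obtain U where U: "open U" "profiles own X \<subseteq> U" "\<forall>x\<in>U. P differentiable (at x)"
      "continuous_on U (gradient P)"
    using A2 by (auto simp: weighted_potential_def)
  interpret async_game own X f L w P U \<mu> p Q \<xi> M x idx smp d \<epsilon> \<tau>
  proof
    show "X i \<subseteq> block own i" for i
      using game by (simp add: stochastic_game_def)
    show "compact (X i)" "convex (X i)" "0 < L i" for i
      using A1 by (simp_all add: assumption_A1_def)
    show "convex_on (X i) (\<lambda>y. f i (upd own i y z))" if "z \<in> profiles own X" for i z
      using A1 that by (simp add: assumption_A1_def)
    show "(\<lambda>y. f i (upd own i y z)) differentiable (at y)" if "z \<in> profiles own X" "y \<in> X i" for i z y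
      using A1 that by (simp add: assumption_A1_def)
    show "norm (pgrad own i (f i) z - pgrad own i (f i) z') \<le> L i * norm (z - z')"
      if "z \<in> profiles own X" "z' \<in> profiles own X" for i z z'
      using A1 that by (simp add: assumption_A1_def)
    show "0 < w i" for i using A2 by (simp add: weighted_potential_def)
    show "P (upd own i y z) - P (upd own i y' z) = w i * (f i (upd own i y z) - f i (upd own i y' z))"
      if "z \<in> profiles own X" "y \<in> X i" "y' \<in> X i" for i z y y'
      using A2 that by (simp add: weighted_potential_def)
  qed (use U scheme A3 mu in auto)
  show ?thesis
    by (intro conjI allI residuals_summable limit_points_nash_AE attracted_to_connected_set gap_expectation)
qed

end
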